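(* Let $R\subset S$ be a seminormal infra-integral extension such that the conductor $(R:S)$ is a locally maximal ideal of $R$ and, for each $P\in\mathrm{Spec}(R)$, the fiber at $P$ of $R\subset S$ has at most two elements. Then $R\subset S$ is a distributive and locally minimal decomposed extension. Moreover, $R\subset S$ has FCP (and then FIP) if and only if $\mathrm{MSupp}(S/R)$ has finitely many elements.
   Context: All rings are commutative with unit. $[R,S]$ denotes the set of all $R$-subalgebras of $S$, ordered by inclusion; it is a lattice with infimum $T\cap U$ and supremum the compositum $TU$. The extension $R\subseteq S$ is distributive if the lattice $[R,S]$ is distributive; it has FCP if every chain in $[R,S]$ is finite, and FIP if $[R,S]$ is finite. For $P\in\mathrm{Spec}(R)$, $S_P$ is the localization of $S$ at $R\setminus P$; $\mathrm{Supp}(S/R)=\{P\in\mathrm{Spec}(R)\mid R_P\neq S_P\}$ and $\mathrm{MSupp}(S/R)=\mathrm{Supp}(S/R)\cap\mathrm{Max}(R)$. The fiber at $P$ is the set of primes $Q$ of $S$ with $Q\cap R=P$. The conductor is $(R:S)=\{x\in R\mid xS\subseteq R\}$. An ideal $I$ of $R$ is locally maximal if for each $P\in\mathrm{Spec}(R)$, either $I_P=R_P$ or $I_P=PR_P$. An extension $R\subseteq S$ is seminormal if $b\in S$, $b^2\in R$, $b^3\in R$ imply $b\in R$. An integral extension $R\subseteq S$ is infra-integral if for every $Q\in\mathrm{Spec}(S)$ with $P:=Q\cap R$, the residual extension $R_P/PR_P\to S_Q/QS_Q$ is an isomorphism. An extension $A\subset B$ ($A\neq B$) is minimal if $[A,B]=\{A,B\}$;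 it is minimal decomposed if it is minimal, integral, $M:=(A:B)\in\mathrm{Max}(A)$, and there exist two distinct $M_1,M_2\in\mathrm{Max}(B)$ with $M=M_1\cap M_2$ and the natural maps $A/M\to B/M_1$ and $A/M\to B/M_2$ isomorphisms. $R\subset S$ is locally minimal decomposed if $R_P\subset S_P$ is minimal decomposed for each $P\in\mathrm{Supp}(S/R)$. *)

theory Defs
  imports "HOL-Algebra.Algebra"
begin

text \<open>
  A ring extension is a commutative ring \<open>S\<close> (a HOL-Algebra record) together with a subset
  \<open>R\<close> of its carrier that is a subring.  The ring \<open>R\<close> itself is the record
  \<open>S\<lparr>carrier := R\<rparr>\<close>.
\<close>

definition ring_extension :: "'a set \<Rightarrow> ('a, 'b) ring_scheme \<Rightarrow> bool" where
  "ring_extension R S \<longleftrightarrow> cring S \<and> subring R S"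


subsection \<open>The lattice of intermediate rings\<close>

definition intermediate_rings :: "'a set \<Rightarrow> ('a, 'b) ring_scheme \<Rightarrow> 'a set set" where
  "intermediate_rings R S = {T. subring T S \<and> R \<subseteq> T}"

definition compositum :: "('a, 'b) ring_scheme \<Rightarrow> 'a set \<Rightarrow> 'a set \<Rightarrow> 'a set" where
  "compositum S T U = generate_ring S (T \<union> U)"

definition distributive_extension :: "'a set \<Rightarrow> ('a, 'b) ring_scheme \<Rightarrow> bool" where
  "distributive_extension R S \<longleftrightarrow>
     (\<forall>T\<in>intermediate_rings R S. \<forall>U\<in>intermediate_rings R S. \<forall>V\<in>intermediate_rings R S.
        T \<inter> compositum S U V = compositum S (T \<inter> U) (T \<inter> V))"

definition FCP :: "'a set \<Rightarrow> ('a, 'b) ring_scheme \<Rightarrow> bool" where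
  "FCP R S \<longleftrightarrow> (\<forall>\<C>. subset.chain (intermediate_rings R S) \<C> \<longrightarrow> finite \<C>)"

definition FIP :: "'a set \<Rightarrow> ('a, 'b) ring_scheme \<Rightarrow> bool" where
  "FIP R S \<longleftrightarrow> finite (intermediate_rings R S)"


subsection \<open>Rings of fractions\<close>

text \<open>
  \<open>M\<close> is meant to be a multiplicative submonoid of \<open>A\<close>; zero divisors are allowed, hence the
  factor \<open>u\<close>.
\<close>

definition loc_rel :: "('a, 'b) ring_scheme \<Rightarrow> 'a set \<Rightarrow> (('a \<times> 'a) \<times> ('a \<times> 'a)) set" where
  "loc_rel A M =
     {((a, s), (b, t)) | a s b t. a \<in> carrier A \<and> b \<in> carrier A \<and> s \<in> M \<and> t \<in> M \<and>
        (\<exists>u\<in>M. u \<otimes>\<^bsub>A\<^esub> (t \<otimes>\<^bsub>A\<^esub> a \<ominus>\<^bsub>A\<^esub> s \<otimes>\<^bsub>A\<^esub> b) = \<zero>\<^bsub>A\<^esub>)}"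

definition loc_frac :: "('a, 'b) ring_scheme \<Rightarrow> 'a set \<Rightarrow> 'a \<Rightarrow> 'a \<Rightarrow> ('a \<times> 'a) set" where
  "loc_frac A M a s = loc_rel A M `` {(a, s)}"

definition localization :: "('a, 'b) ring_scheme \<Rightarrow> 'a set \<Rightarrow> ('a \<times> 'a) set ring" where
  "localization A M =
     \<lparr>carrier = {loc_frac A M a s | a s. a \<in> carrier A \<and> s \<in> M},
      monoid.mult = (\<lambda>x y. \<Union>(a, s)\<in>x. \<Union>(b, t)\<in>y. loc_frac A M (a \<otimes>\<^bsub>A\<^esub> b) (s \<otimes>\<^bsub>A\<^esub> t)),
      monoid.one = loc_frac A M \<one>\<^bsub>A\<^esub> \<one>\<^bsub>A\<^esub>,
      ring.zero = loc_frac A M \<zero>\<^bsub>A\<^esub> \<one>\<^bsub>A\<^esub>,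
      ring.add = (\<lambda>x y. \<Union>(a, s)\<in>x. \<Union>(b, t)\<in>y.
               loc_frac A M (t \<otimes>\<^bsub>A\<^esub> a \<oplus>\<^bsub>A\<^esub> s \<otimes>\<^bsub>A\<^esub> b) (s \<otimes>\<^bsub>A\<^esub> t))\<rparr>"

text \<open>
  The canonical map \<open>a/s \<mapsto> a/s\<close> into \<open>localization B N\<close>, from any \<open>localization A M\<close> with
  \<open>A\<close> a subring of \<open>B\<close> and \<open>M \<subseteq> N\<close>.
\<close>

definition loc_map :: "('a, 'b) ring_scheme \<Rightarrow> 'a set \<Rightarrow> ('a \<times> 'a) set \<Rightarrow> ('a \<times> 'a) set" where
  "loc_map B N x = (\<Union>(a, s)\<in>x. loc_frac B N a s)"

abbreviation loc_at :: "('a, 'b) ring_scheme \<Rightarrow> 'a set \<Rightarrow> ('a \<times> 'a) set ring" where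
  "loc_at A P \<equiv> localization A (carrier A - P)"

text \<open>The localization \<open>I\<^sub>P\<close> of an ideal \<open>I\<close> of \<open>A\<close>, viewed inside \<open>A\<^sub>P\<close>.\<close>

definition loc_ideal :: "('a, 'b) ring_scheme \<Rightarrow> 'a set \<Rightarrow> 'a set \<Rightarrow> ('a \<times> 'a) set set" where
  "loc_ideal A P I = {loc_frac A (carrier A - P) a s | a s. a \<in> I \<and> s \<in> carrier A - P}"

text \<open>The ideal \<open>PA\<^sub>P\<close> of \<open>A\<^sub>P\<close> generated by the image of \<open>P\<close>.\<close>

definition max_loc_at :: "('a, 'b) ring_scheme \<Rightarrow> 'a set \<Rightarrow> ('a \<times> 'a) set set" where
  "max_loc_at A P = Idl\<^bsub>loc_at A P\<^esub> ((\<lambda>a. loc_frac A (carrier A - P) a \<one>\<^bsub>A\<^esub>) ` P)"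

definition locally_maximal_ideal :: "'a set \<Rightarrow> ('a, 'b) ring_scheme \<Rightarrow> bool" where
  "locally_maximal_ideal I A \<longleftrightarrow> ideal I A \<and>
     (\<forall>P. primeideal P A \<longrightarrow>
        loc_ideal A P I = carrier (loc_at A P) \<or> loc_ideal A P I = max_loc_at A P)"


subsection \<open>Localizing an extension\<close>

text \<open>
  For a prime \<open>P\<close> of \<open>R\<close>, both rings of \<open>R \<subseteq> S\<close> are localized at \<open>R - P\<close>.  To regard
  \<open>R\<^sub>P \<subseteq> S\<^sub>P\<close> again as an extension in the above sense, \<open>R\<^sub>P\<close> is replaced by its image under the
  (injective) canonical map \<open>R\<^sub>P \<rightarrow> S\<^sub>P\<close>.
\<close>

definition ext_loc_top :: "'a set \<Rightarrow> ('a, 'b) ring_scheme \<Rightarrow> 'a set \<Rightarrow> ('a \<times> 'a) set ring" where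
  "ext_loc_top R S P = localization S (R - P)"

definition ext_loc_base :: "'a set \<Rightarrow> ('a, 'b) ring_scheme \<Rightarrow> 'a set \<Rightarrow> ('a \<times> 'a) set set" where
  "ext_loc_base R S P = loc_map S (R - P) ` carrier (loc_at (S\<lparr>carrier := R\<rparr>) P)"

definition ext_supp :: "'a set \<Rightarrow> ('a, 'b) ring_scheme \<Rightarrow> 'a set set" where
  "ext_supp R S =
     {P. primeideal P (S\<lparr>carrier := R\<rparr>) \<and> ext_loc_base R S P \<noteq> carrier (ext_loc_top R S P)}"

definition ext_msupp :: "'a set \<Rightarrow> ('a, 'b) ring_scheme \<Rightarrow> 'a set set" where
  "ext_msupp R S = ext_supp R S \<inter> {P. maximalideal P (S\<lparr>carrier := R\<rparr>)}"


subsection \<open>Classes of extensions\<close>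

definition ext_conductor :: "'a set \<Rightarrow> ('a, 'b) ring_scheme \<Rightarrow> 'a set" where
  "ext_conductor R S = {x \<in> R. \<forall>s\<in>carrier S. x \<otimes>\<^bsub>S\<^esub> s \<in> R}"

definition ext_fiber :: "'a set \<Rightarrow> ('a, 'b) ring_scheme \<Rightarrow> 'a set \<Rightarrow> 'a set set" where
  "ext_fiber R S P = {Q. primeideal Q S \<and> Q \<inter> R = P}"

definition seminormal_extension :: "'a set \<Rightarrow> ('a, 'b) ring_scheme \<Rightarrow> bool" where
  "seminormal_extension R S \<longleftrightarrow> ring_extension R S \<and>
     (\<forall>b\<in>carrier S. b [^]\<^bsub>S\<^esub> (2::nat) \<in> R \<and> b [^]\<^bsub>S\<^esub> (3::nat) \<in> R \<longrightarrow> b \<in> R)"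

text \<open>Coefficient lists start with the leading coefficient, so \<open>\<one> # p\<close> is a monic polynomial.\<close>

definition integral_extension :: "'a set \<Rightarrow> ('a, 'b) ring_scheme \<Rightarrow> bool" where
  "integral_extension R S \<longleftrightarrow> ring_extension R S \<and>
     (\<forall>x\<in>carrier S. \<exists>p. set p \<subseteq> R \<and> ring.eval S (\<one>\<^bsub>S\<^esub> # p) x = \<zero>\<^bsub>S\<^esub>)"

text \<open>
  The map \<open>A/I \<rightarrow> B/J\<close> induced by a homomorphism \<open>f : A \<rightarrow> B\<close> with \<open>f(I) \<subseteq> J\<close>; its argument
  is a coset of \<open>I\<close>.
\<close>

definition quot_map :: "('c, 'd) ring_scheme \<Rightarrow> 'c set \<Rightarrow> ('a \<Rightarrow> 'c) \<Rightarrow> 'a set \<Rightarrow> 'c set" where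
  "quot_map B J f C = the_elem ((\<lambda>x. J +>\<^bsub>B\<^esub> f x) ` C)"

definition infra_integral_extension :: "'a set \<Rightarrow> ('a, 'b) ring_scheme \<Rightarrow> bool" where
  "infra_integral_extension R S \<longleftrightarrow> integral_extension R S \<and>
     (\<forall>Q P. primeideal Q S \<and> P = Q \<inter> R \<longrightarrow>
        quot_map (loc_at S Q) (max_loc_at S Q) (loc_map S (carrier S - Q))
          \<in> ring_iso (loc_at (S\<lparr>carrier := R\<rparr>) P Quot max_loc_at (S\<lparr>carrier := R\<rparr>) P)
                     (loc_at S Q Quot max_loc_at S Q))"

definition minimal_extension :: "'a set \<Rightarrow> ('a, 'b) ring_scheme \<Rightarrow> bool" where
  "minimal_extension A B \<longleftrightarrow> ring_extension A B \<and> A \<noteq> carrier B \<and>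
     intermediate_rings A B = {A, carrier B}"

definition minimal_decomposed :: "'a set \<Rightarrow> ('a, 'b) ring_scheme \<Rightarrow> bool" where
  "minimal_decomposed A B \<longleftrightarrow> minimal_extension A B \<and> integral_extension A B \<and>
     maximalideal (ext_conductor A B) (B\<lparr>carrier := A\<rparr>) \<and>
     (\<exists>M\<^sub>1 M\<^sub>2. maximalideal M\<^sub>1 B \<and> maximalideal M\<^sub>2 B \<and> M\<^sub>1 \<noteq> M\<^sub>2 \<and>
        ext_conductor A B = M\<^sub>1 \<inter> M\<^sub>2 \<and>
        quot_map B M\<^sub>1 (\<lambda>x. x) \<in> ring_iso (B\<lparr>carrier := A\<rparr> Quot ext_conductor A B) (B Quot M\<^sub>1) \<and>
        quot_map B M\<^sub>2 (\<lambda>x. x) \<in> ring_iso (B\<lparr>carrier := A\<rparr> Quot ext_conductor A B) (B Quot M\<^sub>2))"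

definition locally_minimal_decomposed :: "'a set \<Rightarrow> ('a, 'b) ring_scheme \<Rightarrow> bool" where
  "locally_minimal_decomposed R S \<longleftrightarrow> ring_extension R S \<and>
     (\<forall>P\<in>ext_supp R S. minimal_decomposed (ext_loc_base R S P) (ext_loc_top R S P))"

end

theory Submission
  imports Defs
begin

text \<open>
  Let \<open>I = (R : S)\<close>. Two consequences of the hypotheses carry the proof.

  Local maximality of \<open>I\<close> says that for a prime \<open>P\<close> of \<open>R\<close> containing \<open>I\<close>, every \<open>p \<in> P\<close> has a
  multiple \<open>s p \<in> I\<close> with \<open>s \<in> R - P\<close> (\<open>locally_maximalD\<close>). So the primes over \<open>I\<close> are maximal
  and pairwise incomparable; and since \<open>R\<^sub>P = S\<^sub>P\<close> unless \<open>I \<subseteq> P\<close>, the support consists of maximal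
  ideals.

  Seminormality makes \<open>I\<close> a radical ideal of \<open>S\<close> (\<open>conductor_radical\<close>). So an element \<open>z\<close> of \<open>S\<close>
  in all primes of the fiber at \<open>P \<supseteq> I\<close> has a multiple \<open>s z \<in> I\<close> with \<open>s \<in> R - P\<close>
  (\<open>fiber_radical\<close>): otherwise some prime of \<open>S\<close> over \<open>I\<close> would avoid all \<open>s z\<^sup>n\<close>, and by
  incomparability this prime would lie in the fiber.

  Now let \<open>P\<close> be in the support. As residue fields do not grow, each \<open>x \<in> S\<close> is congruent to an
  element of \<open>R\<close> modulo each prime of the fiber. If the fiber had at most one prime, then every
  \<open>x\<close> would differ from an element of \<open>R\<close> by an element of all primes of the fiber, hence lie in
  \<open>R\<^sub>P\<close>; so the fiber has exactly two primes (\<open>supp_fiber\<close>). Then \<open>R\<^sub>P \<subseteq> S\<^sub>P\<close> is the pullback of the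
  diagonal \<open>k \<rightarrow> k \<times> k\<close> of the residue field, which is minimal decomposed
  (\<open>minimal_decomposedI\<close>, \<open>minimal_decomposed_at\<close>).

  The rest is the passage from local to global. An intermediate ring \<open>T\<close> is determined by its
  localizations \<open>T\<^sub>P\<close> (\<open>sat_local\<close>), each of which is now \<open>R\<^sub>P\<close> or \<open>S\<^sub>P\<close> (\<open>sat_dichotomy\<close>). So \<open>T\<close> is
  determined by the set of those \<open>P\<close> in the support with \<open>T\<^sub>P = S\<^sub>P\<close>. Intersections and composita
  are compatible with localization and correspond to intersections and unions of such sets,
  whence distributivity; and a finite support leaves finitely many intermediate rings. If the
  support is infinite, choose distinct \<open>P\<^sub>0, P\<^sub>1, \<dots>\<close> in it: requiring \<open>x \<in> R\<^sub>P\<close> at more and more of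
  them gives an infinite strictly descending chain (\<open>finite_supp_if_FCP\<close>).
\<close>

section \<open>Ideals, maximal ideals and primes\<close>

text \<open>
  Closure under negation is multiplication by \<open>-1\<close>.
\<close>

lemma (in cring) idealI_cring:
  assumes "I \<subseteq> carrier R" "\<zero> \<in> I" "\<And>x y. x \<in> I \<Longrightarrow> y \<in> I \<Longrightarrow> x \<oplus> y \<in> I"
    and mult: "\<And>r x. r \<in> carrier R \<Longrightarrow> x \<in> I \<Longrightarrow> r \<otimes> x \<in> I"
  shows "ideal I R"
proof (rule idealI)
  have c: "x \<in> carrier R" if "x \<in> I" for x using that assms(1) by auto
  show "ring R" by (rule ring_axioms)
  show "subgroup I (add_monoid R)"
  proof (rule add.subgroupI)
    fix x assume x: "x \<in> I"
    then have "(\<ominus> \<one>) \<otimes> x \<in> I" by (intro mult) auto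
    then show "\<ominus> x \<in> I" using c[OF x] by (simp add: l_minus)
  qed (use assms in auto)
  show "r \<otimes> x \<in> I" "x \<otimes> r \<in> I" if "x \<in> I" "r \<in> carrier R" for x r
    using mult[of r x] that c by (auto simp: m_comm)
qed

lemma (in cring) maximalidealI_units:
  assumes "ideal m R" "\<one> \<notin> m" "\<And>a. a \<in> carrier R \<Longrightarrow> a \<notin> m \<Longrightarrow> \<exists>u\<in>carrier R. u \<otimes> a = \<one>"
  shows "maximalideal m R"
proof (rule maximalidealI)
  show "ideal m R" "carrier R \<noteq> m" using assms by auto
  fix J assume J: "ideal J R" "m \<subseteq> J" "J \<subseteq> carrier R"
  interpret J: ideal J R by fact
  show "J = m \<or> J = carrier R"
  proof (rule disjCI)
    assume J1: "J \<noteq> carrier R"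
    have "a \<in> m" if a: "a \<in> J" for a
    proof (rule ccontr)
      assume "a \<notin> m"
      with assms(3) a obtain u where "u \<in> carrier R" "u \<otimes> a = \<one>" using J.Icarr by blast
      then have "\<one> \<in> J" using J.I_l_closed[OF a] by metis
      then show False using J1 J.one_imp_carrier by simp
    qed
    then show "J = m" using J(2) by blast
  qed
qed

text \<open>
  The equation avoids subtraction, so that for a subring in place of \<open>R\<close> it involves only
  operations that the subring shares with the ambient ring.
\<close>

lemma (in cring) inverse_mod_maximalideal:
  assumes m: "maximalideal m R" and a: "a \<in> carrier R" "a \<notin> m"
  obtains i u where "i \<in> m" "u \<in> carrier R" "i \<oplus> u \<otimes> a = \<one>"
proof -
  interpret m: maximalideal m R by fact
  let ?J = "m <+>\<^bsub>R\<^esub> PIdl a"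
  have J: "ideal ?J R" by (intro add_ideals m.is_ideal cgenideal_ideal a)
  interpret J: ideal ?J R by fact
  have mem: "i \<oplus> u \<otimes> a \<in> ?J" if "i \<in> m" "u \<in> carrier R" for i u
    using that unfolding set_add_def' cgenideal_def by blast
  have "i \<in> ?J" if "i \<in> m" for i using mem[OF that zero_closed] m.Icarr[OF that] a by simp
  moreover have "a \<in> ?J" using mem[OF m.zero_closed one_closed] a by simp
  ultimately have "?J = carrier R" using m.I_maximal[OF J] a J.Icarr by blast
  then have "\<one> \<in> ?J" by simp
  then show ?thesis using that unfolding set_add_def' cgenideal_def by auto
qed

lemma (in cring) subring_cring:
  assumes "subring T R" shows "cring (R\<lparr>carrier := T\<rparr>)"
  by (rule subcring_iff[THEN iffD1, OF subringE(1)[OF assms] subcringI'[OF assms]])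

text \<open>
  An ideal maximal among those that contain \<open>I\<close> and miss \<open>N\<close> is prime: if \<open>a\<close> and \<open>b\<close> are outside
  \<open>Q\<close>, then \<open>Q + Ra\<close> and \<open>Q + Rb\<close> both meet \<open>N\<close>, so their product does. The product is contained
  in \<open>Q + Rab\<close>, which therefore differs from \<open>Q\<close>.
\<close>

lemma (in cring) exists_prime_avoiding:
  assumes I: "ideal I R"
    and N: "N \<subseteq> carrier R" "\<one> \<in> N" "\<And>x y. x \<in> N \<Longrightarrow> y \<in> N \<Longrightarrow> x \<otimes> y \<in> N"
    and disj: "I \<inter> N = {}"
  obtains Q where "primeideal Q R" "I \<subseteq> Q" "Q \<inter> N = {}"
proof -
  let ?F = "{J. ideal J R \<and> I \<subseteq> J \<and> J \<inter> N = {}}"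
  have "\<exists>Q\<in>?F. (\<forall>J\<in>?F. Q \<subseteq> J \<longrightarrow> J = Q)"
  proof (rule subset_Zorn_nonempty)
    show "?F \<noteq> {}" using I disj by auto
    fix C assume C: "C \<noteq> {}" "subset.chain ?F C"
    then have "subset.chain {J. ideal J R} C" by (auto simp: pred_on.chain_def)
    with C(1) have "ideal (\<Union>C) R" using chain_Union_is_ideal[of C] by simp
    moreover from C obtain J where "J \<in> C" "I \<subseteq> J" by (auto simp: pred_on.chain_def)
    then have "I \<subseteq> \<Union>C" by auto
    moreover have "\<Union>C \<inter> N = {}" using C(2) by (auto simp: pred_on.chain_def)
    ultimately show "\<Union>C \<in> ?F" by simp
  qed
  then obtain Q where Q: "ideal Q R" "I \<subseteq> Q" "Q \<inter> N = {}"
    and max: "\<And>J. ideal J R \<Longrightarrow> I \<subseteq> J \<Longrightarrow> J \<inter> N = {} \<Longrightarrow> Q \<subseteq> J \<Longrightarrow> J = Q"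
    by auto
  interpret Q: ideal Q R by fact
  have meets: "\<exists>q\<in>Q. \<exists>r\<in>carrier R. q \<oplus> r \<otimes> a \<in> N" if a: "a \<in> carrier R" "a \<notin> Q" for a
  proof -
    let ?J = "Q <+>\<^bsub>R\<^esub> PIdl a"
    have J: "ideal ?J R" by (intro add_ideals Q cgenideal_ideal a)
    have "q \<in> ?J" if "q \<in> Q" for q
    proof -
      have "q \<oplus> \<zero> \<otimes> a \<in> ?J"
        using that zero_closed unfolding set_add_def' cgenideal_def by blast
      then show ?thesis using a(1) Q.Icarr[OF that] by simp
    qed
    then have sub: "Q \<subseteq> ?J" by auto
    have "\<zero> \<oplus> \<one> \<otimes> a \<in> ?J"
      using Q.zero_closed one_closed unfolding set_add_def' cgenideal_def by blast
    with a(1) have "a \<in> ?J" by simp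
    with a(2) have "?J \<noteq> Q" by auto
    with max[OF J] sub Q(2) have "?J \<inter> N \<noteq> {}" by blast
    then show ?thesis unfolding set_add_def' cgenideal_def by blast
  qed
  have "primeideal Q R"
  proof (rule primeidealI)
    show "ideal Q R" "cring R" by (fact, rule is_cring)
    show "carrier R \<noteq> Q" using N Q(3) by auto
    fix a b assume ab: "a \<in> carrier R" "b \<in> carrier R" "a \<otimes> b \<in> Q"
    show "a \<in> Q \<or> b \<in> Q"
    proof (rule ccontr)
      assume "\<not> (a \<in> Q \<or> b \<in> Q)"
      then have n: "a \<notin> Q" "b \<notin> Q" by auto
      obtain q r where q: "q \<in> Q" "r \<in> carrier R" "q \<oplus> r \<otimes> a \<in> N"
        using meets[OF ab(1) n(1)] by auto
      obtain q' r' where q': "q' \<in> Q" "r' \<in> carrier R" "q' \<oplus> r' \<otimes> b \<in> N"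
        using meets[OF ab(2) n(2)] by auto
      note c = Q.Icarr[OF q(1)] Q.Icarr[OF q'(1)] q(2) q'(2) ab(1,2)
      have "(q \<oplus> r \<otimes> a) \<otimes> (q' \<oplus> r' \<otimes> b)
        = q \<otimes> (q' \<oplus> r' \<otimes> b) \<oplus> (r \<otimes> a) \<otimes> q' \<oplus> (r \<otimes> r') \<otimes> (a \<otimes> b)"
        using c by algebra
      also have "\<dots> \<in> Q"
        using c Q.I_r_closed[OF q(1)] Q.I_l_closed[OF q'(1)] Q.I_l_closed[OF ab(3)] by simp
      finally show False using N(3)[OF q(3) q'(3)] Q(3) by auto
    qed
  qed
  with that Q show ?thesis by blast
qed

section \<open>Rings of fractions\<close>

text \<open>
  Sum and product in \<open>localization\<close> are unions over all pairs of representatives; independence of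
  the representatives evaluates them.
\<close>

lemma UN_case_prod_const:
  assumes "\<And>a s b t. (a, s) \<in> x \<Longrightarrow> (b, t) \<in> y \<Longrightarrow> f a s b t = C" "p \<in> x" "q \<in> y"
  shows "(\<Union>(a, s)\<in>x. \<Union>(b, t)\<in>y. f a s b t) = C"
proof -
  have "(\<Union>(a, s)\<in>x. \<Union>(b, t)\<in>y. f a s b t) = (\<Union>(a, s)\<in>x. \<Union>(b, t)\<in>y. C)"
    using assms(1) by (intro SUP_cong refl) (auto split: prod.splits)
  also have "\<dots> = C" using assms(2,3) by (auto split: prod.splits)
  finally show ?thesis .
qed

locale fractions = cring A for A (structure) + fixes M
  assumes M_sub: "M \<subseteq> carrier A" and one_M: "\<one> \<in> M"
    and mult_M: "\<And>s t. s \<in> M \<Longrightarrow> t \<in> M \<Longrightarrow> s \<otimes> t \<in> M"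
begin

abbreviation "fract \<equiv> loc_frac A M"
abbreviation "L \<equiv> localization A M"

lemma M_carr [simp]: "s \<in> M \<Longrightarrow> s \<in> carrier A" using M_sub by auto

text \<open>
  The form without subtraction, for which transitivity is a chain of multiplications.
\<close>

lemma loc_rel_iff: "((a, s), (b, t)) \<in> loc_rel A M \<longleftrightarrow> a \<in> carrier A \<and> b \<in> carrier A \<and> s \<in> M \<and> t \<in> M \<and>
    (\<exists>u\<in>M. u \<otimes> (t \<otimes> a) = u \<otimes> (s \<otimes> b))"
proof -
  have "u \<otimes> (t \<otimes> a \<ominus> s \<otimes> b) = \<zero> \<longleftrightarrow> u \<otimes> (t \<otimes> a) = u \<otimes> (s \<otimes> b)"
    if "a \<in> carrier A" "b \<in> carrier A" "s \<in> M" "t \<in> M" "u \<in> M" for u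
  proof -
    have "u \<otimes> (t \<otimes> a \<ominus> s \<otimes> b) = u \<otimes> (t \<otimes> a) \<ominus> u \<otimes> (s \<otimes> b)"
      using that(1,2) that(3-5)[THEN M_carr] by algebra
    then show ?thesis using that by simp
  qed
  then show ?thesis unfolding loc_rel_def by blast
qed

lemma equiv_loc_rel: "equiv (carrier A \<times> M) (loc_rel A M)"
proof (rule equivI)
  show "loc_rel A M \<subseteq> (carrier A \<times> M) \<times> carrier A \<times> M" by (auto simp: loc_rel_def)
  show "refl_on (carrier A \<times> M) (loc_rel A M)"
    using one_M by (auto simp: refl_on_def loc_rel_iff)
  show "sym (loc_rel A M)" by (force intro!: symI simp: loc_rel_iff)
  show "trans (loc_rel A M)"
  proof (rule transI, clarify)
    fix a s b t c r
    assume "((a, s), (b, t)) \<in> loc_rel A M" "((b, t), (c, r)) \<in> loc_rel A M"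
    then obtain u v where h: "a \<in> carrier A" "b \<in> carrier A" "c \<in> carrier A" "s \<in> M" "t \<in> M" "r \<in> M"
       "u \<in> M" "v \<in> M" "u \<otimes> (t \<otimes> a) = u \<otimes> (s \<otimes> b)" "v \<otimes> (r \<otimes> b) = v \<otimes> (t \<otimes> c)"
      by (auto simp: loc_rel_iff)
    note c = h(1-3) h(4-8)[THEN M_carr]
    have "(u \<otimes> v \<otimes> t) \<otimes> (r \<otimes> a) = (v \<otimes> r) \<otimes> (u \<otimes> (t \<otimes> a))" using c by algebra
    also have "\<dots> = (v \<otimes> r) \<otimes> (u \<otimes> (s \<otimes> b))" by (simp add: h)
    also have "\<dots> = (u \<otimes> s) \<otimes> (v \<otimes> (r \<otimes> b))" using c by algebra
    also have "\<dots> = (u \<otimes> s) \<otimes> (v \<otimes> (t \<otimes> c))" by (simp add: h)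
    also have "\<dots> = (u \<otimes> v \<otimes> t) \<otimes> (s \<otimes> c)" using c by algebra
    finally show "((a, s), (c, r)) \<in> loc_rel A M"
      using h mult_M by (auto simp: loc_rel_iff)
  qed
qed

lemma frac_eq_iff:
  assumes "a \<in> carrier A" "b \<in> carrier A" "s \<in> M" "t \<in> M"
  shows "fract a s = fract b t \<longleftrightarrow> (\<exists>u\<in>M. u \<otimes> (t \<otimes> a) = u \<otimes> (s \<otimes> b))"
  unfolding loc_frac_def using eq_equiv_class_iff[OF equiv_loc_rel, of "(a,s)" "(b,t)"] assms
  by (auto simp: loc_rel_iff)

lemma frac_eqI:
  assumes "t \<otimes> a = s \<otimes> b" "a \<in> carrier A" "b \<in> carrier A" "s \<in> M" "t \<in> M"
  shows "fract a s = fract b t"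
  using assms one_M by (auto simp: frac_eq_iff)

lemma mem_frac_iff: "(b, t) \<in> fract a s \<longleftrightarrow> a \<in> carrier A \<and> b \<in> carrier A \<and> s \<in> M \<and> t \<in> M \<and> fract b t = fract a s"
proof -
  have "(b, t) \<in> fract a s \<longleftrightarrow> ((a, s), (b, t)) \<in> loc_rel A M" by (simp add: loc_frac_def)
  then show ?thesis using frac_eq_iff[of a b s t] by (auto simp: loc_rel_iff)
qed

lemma frac_carrier [simp, intro]: "a \<in> carrier A \<Longrightarrow> s \<in> M \<Longrightarrow> fract a s \<in> carrier L"
  by (auto simp: localization_def)

lemma fracE:
  assumes "x \<in> carrier L" obtains a s where "x = fract a s" "a \<in> carrier A" "s \<in> M"
  using assms by (auto simp: localization_def)

lemma frac_mult:
  assumes "a \<in> carrier A" "b \<in> carrier A" "s \<in> M" "t \<in> M"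
  shows "fract a s \<otimes>\<^bsub>L\<^esub> fract b t = fract (a \<otimes> b) (s \<otimes> t)"
proof -
  have const: "fract (a' \<otimes> b') (s' \<otimes> t') = fract (a \<otimes> b) (s \<otimes> t)"
    if "(a', s') \<in> fract a s" "(b', t') \<in> fract b t" for a' s' b' t'
  proof -
    from that have c0: "a' \<in> carrier A" "b' \<in> carrier A" "s' \<in> M" "t' \<in> M" by (auto simp: mem_frac_iff)
    from that assms obtain u v where h: "u \<in> M" "v \<in> M"
      "u \<otimes> (s \<otimes> a') = u \<otimes> (s' \<otimes> a)" "v \<otimes> (t \<otimes> b') = v \<otimes> (t' \<otimes> b)"
      by (force simp: mem_frac_iff frac_eq_iff)
    note c = assms(1,2) assms(3,4)[THEN M_carr] c0(1,2) c0(3,4)[THEN M_carr] h(1,2)[THEN M_carr]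
    have "(u \<otimes> v) \<otimes> ((s \<otimes> t) \<otimes> (a' \<otimes> b')) = (u \<otimes> (s \<otimes> a')) \<otimes> (v \<otimes> (t \<otimes> b'))" using c by algebra
    also have "\<dots> = (u \<otimes> v) \<otimes> ((s' \<otimes> t') \<otimes> (a \<otimes> b))" unfolding h using c by algebra
    finally show ?thesis using assms c0 h mult_M by (auto simp: frac_eq_iff)
  qed
  have mem: "(a, s) \<in> fract a s" "(b, t) \<in> fract b t" using assms by (auto simp: mem_frac_iff)
  have "fract a s \<otimes>\<^bsub>L\<^esub> fract b t = (\<Union>(a, s)\<in>fract a s. \<Union>(b, t)\<in>fract b t. fract (a \<otimes> b) (s \<otimes> t))"
    by (simp only: localization_def monoid.simps ring.simps)
  also have "\<dots> = fract (a \<otimes> b) (s \<otimes> t)" by (rule UN_case_prod_const[OF const mem])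
  finally show ?thesis .
qed

lemma frac_add:
  assumes "a \<in> carrier A" "b \<in> carrier A" "s \<in> M" "t \<in> M"
  shows "fract a s \<oplus>\<^bsub>L\<^esub> fract b t = fract (t \<otimes> a \<oplus> s \<otimes> b) (s \<otimes> t)"
proof -
  have const: "fract (t' \<otimes> a' \<oplus> s' \<otimes> b') (s' \<otimes> t') = fract (t \<otimes> a \<oplus> s \<otimes> b) (s \<otimes> t)"
    if "(a', s') \<in> fract a s" "(b', t') \<in> fract b t" for a' s' b' t'
  proof -
    from that have c0: "a' \<in> carrier A" "b' \<in> carrier A" "s' \<in> M" "t' \<in> M" by (auto simp: mem_frac_iff)
    from that assms obtain u v where h: "u \<in> M" "v \<in> M"
      "u \<otimes> (s \<otimes> a') = u \<otimes> (s' \<otimes> a)" "v \<otimes> (t \<otimes> b') = v \<otimes> (t' \<otimes> b)"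
      by (force simp: mem_frac_iff frac_eq_iff)
    note c = assms(1,2) assms(3,4)[THEN M_carr] c0(1,2) c0(3,4)[THEN M_carr] h(1,2)[THEN M_carr]
    have "(u \<otimes> v) \<otimes> ((s \<otimes> t) \<otimes> (t' \<otimes> a' \<oplus> s' \<otimes> b'))
      = (u \<otimes> (s \<otimes> a')) \<otimes> (v \<otimes> t \<otimes> t') \<oplus> (v \<otimes> (t \<otimes> b')) \<otimes> (u \<otimes> s \<otimes> s')" using c by algebra
    also have "\<dots> = (u \<otimes> v) \<otimes> ((s' \<otimes> t') \<otimes> (t \<otimes> a \<oplus> s \<otimes> b))" unfolding h using c by algebra
    finally show ?thesis using assms c0 h mult_M by (auto simp: frac_eq_iff)
  qed
  have mem: "(a, s) \<in> fract a s" "(b, t) \<in> fract b t" using assms by (auto simp: mem_frac_iff)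
  have "fract a s \<oplus>\<^bsub>L\<^esub> fract b t = (\<Union>(a, s)\<in>fract a s. \<Union>(b, t)\<in>fract b t. fract (t \<otimes> a \<oplus> s \<otimes> b) (s \<otimes> t))"
    by (simp only: localization_def monoid.simps ring.simps)
  also have "\<dots> = fract (t \<otimes> a \<oplus> s \<otimes> b) (s \<otimes> t)" by (rule UN_case_prod_const[OF const mem])
  finally show ?thesis .
qed

lemma frac_one: "\<one>\<^bsub>L\<^esub> = fract \<one> \<one>" and frac_zero: "\<zero>\<^bsub>L\<^esub> = fract \<zero> \<one>"
  by (simp_all add: localization_def)

lemma frac_zero_num: "s \<in> M \<Longrightarrow> fract \<zero> s = \<zero>\<^bsub>L\<^esub>"
  unfolding frac_zero using one_M by (intro frac_eqI) auto

lemma L_cring: "cring L"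
proof (rule cringI)
  show "abelian_group L"
  proof (rule abelian_groupI)
    fix x y assume "x \<in> carrier L" "y \<in> carrier L"
    then obtain a s b t where h: "x = fract a s" "a \<in> carrier A" "s \<in> M" "y = fract b t" "b \<in> carrier A" "t \<in> M"
      by (metis fracE)
    note c = h(2,5) h(3,6)[THEN M_carr]
    show "x \<oplus>\<^bsub>L\<^esub> y \<in> carrier L" using h c one_M mult_M by (auto simp: frac_add)
    show "x \<oplus>\<^bsub>L\<^esub> y = y \<oplus>\<^bsub>L\<^esub> x" using h c by (simp add: frac_add a_comm m_comm)
    fix z assume "z \<in> carrier L"
    then obtain d r where z: "z = fract d r" "d \<in> carrier A" "r \<in> M" by (metis fracE)
    note c' = c z(2) z(3)[THEN M_carr]
    have "(s \<otimes> (t \<otimes> r)) \<otimes> (r \<otimes> (t \<otimes> a \<oplus> s \<otimes> b) \<oplus> (s \<otimes> t) \<otimes> d)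
      = ((s \<otimes> t) \<otimes> r) \<otimes> ((t \<otimes> r) \<otimes> a \<oplus> s \<otimes> (r \<otimes> b \<oplus> t \<otimes> d))" using c' by algebra
    then show "x \<oplus>\<^bsub>L\<^esub> y \<oplus>\<^bsub>L\<^esub> z = x \<oplus>\<^bsub>L\<^esub> (y \<oplus>\<^bsub>L\<^esub> z)"
      using h z c' mult_M by (simp add: frac_add) (rule frac_eqI, auto)
  next
    show "\<zero>\<^bsub>L\<^esub> \<in> carrier L" using one_M by (auto simp: frac_zero)
    fix x assume "x \<in> carrier L"
    then obtain a s where h: "x = fract a s" "a \<in> carrier A" "s \<in> M" by (metis fracE)
    note c = h(2) h(3)[THEN M_carr]
    show "\<zero>\<^bsub>L\<^esub> \<oplus>\<^bsub>L\<^esub> x = x" using h c one_M mult_M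
      by (auto simp: frac_add frac_zero intro!: frac_eqI)
    have "s \<otimes> (\<ominus> a) \<oplus> s \<otimes> a = \<zero>" using c by algebra
    then have "fract (\<ominus> a) s \<oplus>\<^bsub>L\<^esub> x = \<zero>\<^bsub>L\<^esub>" using h mult_M
      by (simp add: frac_add frac_zero_num)
    then show "\<exists>y\<in>carrier L. y \<oplus>\<^bsub>L\<^esub> x = \<zero>\<^bsub>L\<^esub>" using h by blast
  qed
  show "Group.comm_monoid L"
  proof (rule comm_monoidI)
    show "\<one>\<^bsub>L\<^esub> \<in> carrier L" using one_M by (auto simp: frac_one)
    fix x y assume "x \<in> carrier L" "y \<in> carrier L"
    then obtain a s b t where h: "x = fract a s" "a \<in> carrier A" "s \<in> M" "y = fract b t" "b \<in> carrier A" "t \<in> M"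
      by (metis fracE)
    note c = h(2,5) h(3,6)[THEN M_carr]
    show "x \<otimes>\<^bsub>L\<^esub> y \<in> carrier L" using h c mult_M by (auto simp: frac_mult)
    show "x \<otimes>\<^bsub>L\<^esub> y = y \<otimes>\<^bsub>L\<^esub> x" using h c by (simp add: frac_mult m_comm)
    show "\<one>\<^bsub>L\<^esub> \<otimes>\<^bsub>L\<^esub> x = x" using h c one_M by (auto simp: frac_mult frac_one)
    fix z assume "z \<in> carrier L"
    then obtain d r where z: "z = fract d r" "d \<in> carrier A" "r \<in> M" by (metis fracE)
    show "x \<otimes>\<^bsub>L\<^esub> y \<otimes>\<^bsub>L\<^esub> z = x \<otimes>\<^bsub>L\<^esub> (y \<otimes>\<^bsub>L\<^esub> z)"
      using h z c mult_M by (auto simp: frac_mult m_assoc)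
  qed
  fix x y z assume "x \<in> carrier L" "y \<in> carrier L" "z \<in> carrier L"
  then obtain a s b t d r where h: "x = fract a s" "a \<in> carrier A" "s \<in> M"
    "y = fract b t" "b \<in> carrier A" "t \<in> M" "z = fract d r" "d \<in> carrier A" "r \<in> M"
    by (metis fracE)
  note c = h(2,5,8) h(3,6,9)[THEN M_carr]
  have "((s \<otimes> r) \<otimes> (t \<otimes> r)) \<otimes> ((t \<otimes> a \<oplus> s \<otimes> b) \<otimes> d)
     = ((s \<otimes> t) \<otimes> r) \<otimes> ((t \<otimes> r) \<otimes> (a \<otimes> d) \<oplus> (s \<otimes> r) \<otimes> (b \<otimes> d))" using c by algebra
  then show "(x \<oplus>\<^bsub>L\<^esub> y) \<otimes>\<^bsub>L\<^esub> z = x \<otimes>\<^bsub>L\<^esub> z \<oplus>\<^bsub>L\<^esub> y \<otimes>\<^bsub>L\<^esub> z"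
    using h c mult_M by (simp add: frac_mult frac_add) (rule frac_eqI, auto)
qed

lemma frac_uminus:
  assumes "a \<in> carrier A" "s \<in> M" shows "\<ominus>\<^bsub>L\<^esub> fract a s = fract (\<ominus> a) s"
proof -
  interpret L: cring L by (rule L_cring)
  note c = assms(1) assms(2)[THEN M_carr]
  have "s \<otimes> (\<ominus> a) \<oplus> s \<otimes> a = \<zero>" using c by algebra
  then have "fract (\<ominus> a) s \<oplus>\<^bsub>L\<^esub> fract a s = \<zero>\<^bsub>L\<^esub>" using assms mult_M
    by (simp add: frac_add frac_zero_num)
  then show ?thesis using assms by (intro L.minus_equality) auto
qed

definition fracs :: "'a set \<Rightarrow> ('a \<times> 'a) set set" where
  "fracs T = {fract a s | a s. a \<in> T \<and> s \<in> M}"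

lemma fracsI: "a \<in> T \<Longrightarrow> s \<in> M \<Longrightarrow> fract a s \<in> fracs T"
  by (auto simp: fracs_def)

lemma fracsE:
  assumes "x \<in> fracs T" obtains a s where "x = fract a s" "a \<in> T" "s \<in> M"
  using assms by (auto simp: fracs_def)

lemma fracs_mono: "T \<subseteq> U \<Longrightarrow> fracs T \<subseteq> fracs U"
  by (auto simp: fracs_def)

lemma fracs_subring:
  assumes T: "subring T A" and MT: "M \<subseteq> T"
  shows "subring (fracs T) L"
proof -
  interpret L: cring L by (rule L_cring)
  note TE = subringE[OF T]
  have c: "x \<in> T \<Longrightarrow> x \<in> carrier A" for x using TE by auto
  show ?thesis
  proof (rule L.subringI)
    show "fracs T \<subseteq> carrier L" using c by (auto simp: fracs_def)
    show "\<one>\<^bsub>L\<^esub> \<in> fracs T" using one_M TE(3) by (simp add: frac_one fracsI)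
    fix x assume "x \<in> fracs T"
    then obtain a s where x: "x = fract a s" "a \<in> T" "s \<in> M" by (auto simp: fracs_def)
    then show "\<ominus>\<^bsub>L\<^esub> x \<in> fracs T" using TE(5) c by (simp add: frac_uminus fracsI)
    fix y assume "y \<in> fracs T"
    then obtain b t where y: "y = fract b t" "b \<in> T" "t \<in> M" by (auto simp: fracs_def)
    show "x \<otimes>\<^bsub>L\<^esub> y \<in> fracs T" using x y TE(6) mult_M c by (simp add: frac_mult fracsI)
    have "t \<otimes> a \<oplus> s \<otimes> b \<in> T" using x y MT by (intro TE) auto
    then show "x \<oplus>\<^bsub>L\<^esub> y \<in> fracs T" using x y mult_M c by (simp add: frac_add fracsI)
  qed
qed

lemma fracs_ideal:
  assumes I: "ideal I A"
  shows "ideal (fracs I) L"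
proof -
  interpret L: cring L by (rule L_cring)
  interpret I: ideal I A by fact
  show ?thesis
  proof (rule L.idealI_cring)
    show "fracs I \<subseteq> carrier L" using I.Icarr by (auto simp: fracs_def)
    show "\<zero>\<^bsub>L\<^esub> \<in> fracs I" using one_M I.zero_closed by (simp add: frac_zero fracsI)
    fix x assume "x \<in> fracs I"
    then obtain a s where x: "x = fract a s" "a \<in> I" "s \<in> M" by (rule fracsE)
    {
      fix y assume "y \<in> fracs I"
      then obtain b t where y: "y = fract b t" "b \<in> I" "t \<in> M" by (rule fracsE)
      have "t \<otimes> a \<oplus> s \<otimes> b \<in> I" using x y by (intro I.a_closed I.I_l_closed) auto
      then show "x \<oplus>\<^bsub>L\<^esub> y \<in> fracs I" using x y mult_M I.Icarr by (simp add: frac_add fracsI)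
    next
      fix z assume "z \<in> carrier L"
      then obtain b t where z: "z = fract b t" "b \<in> carrier A" "t \<in> M" by (rule fracE)
      then show "z \<otimes>\<^bsub>L\<^esub> x \<in> fracs I"
        using x mult_M I.I_l_closed I.Icarr by (simp add: frac_mult fracsI)
    }
  qed
qed

text \<open>
  If \<open>a/s = q/t\<close> with \<open>q \<in> Q\<close>, then a priori only some multiple \<open>u t a\<close> with \<open>u, t \<in> M\<close> is in \<open>Q\<close>;
  primeness cancels \<open>u t\<close>.
\<close>

lemma frac_in_fracs_prime:
  assumes "primeideal Q A" "Q \<inter> M = {}" "a \<in> carrier A" "s \<in> M"
  shows "fract a s \<in> fracs Q \<longleftrightarrow> a \<in> Q"
proof
  interpret Q: primeideal Q A by fact
  assume "fract a s \<in> fracs Q"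
  then obtain q t where q: "fract a s = fract q t" "q \<in> Q" "t \<in> M" by (metis fracsE)
  note qc = Q.Icarr[OF q(2)]
  from q(1) obtain u where u: "u \<in> M" "u \<otimes> (t \<otimes> a) = u \<otimes> (s \<otimes> q)"
    using frac_eq_iff[OF assms(3) qc assms(4) q(3)] by blast
  have "u \<otimes> (s \<otimes> q) \<in> Q" using u(1) assms(4) q(2) by (simp add: Q.I_l_closed)
  then have "(u \<otimes> t) \<otimes> a \<in> Q" using u q(3) assms(3) by (simp add: m_assoc)
  moreover have "u \<otimes> t \<in> M" using mult_M u q by auto
  ultimately show "a \<in> Q" using Q.I_prime[of "u \<otimes> t" a] assms by auto
next
  assume "a \<in> Q" then show "fract a s \<in> fracs Q" using assms by (simp add: fracsI)
qed

lemma fracs_prime_ne: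
  assumes "primeideal Q A" "Q \<inter> M = {}" shows "\<one>\<^bsub>L\<^esub> \<notin> fracs Q"
  using frac_in_fracs_prime[OF assms one_closed one_M] one_M assms by (auto simp: frac_one)

end

section \<open>Localization at a prime and residue fields\<close>

lemma (in primeideal) fractions_compl: "fractions R (carrier R - I)"
proof (unfold_locales)
  show "\<one> \<in> carrier R - I" using one_imp_carrier I_notcarr by auto
  show "s \<otimes> t \<in> carrier R - I" if "s \<in> carrier R - I" "t \<in> carrier R - I" for s t
    using that I_prime by auto
qed auto

text \<open>
  Every \<open>p/s\<close> is the multiple \<open>(1/s)(p/1)\<close> of a generator.
\<close>

lemma (in primeideal) max_loc_at_eq: "max_loc_at R I = fractions.fracs R (carrier R - I) I"
proof -
  interpret F: fractions R "carrier R - I" by (rule fractions_compl)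
  interpret L: cring F.L by (rule F.L_cring)
  let ?g = "(\<lambda>a. F.fract a \<one>) ` I"
  have sub: "?g \<subseteq> carrier F.L" using F.one_M Icarr by auto
  show ?thesis
  proof
    show "max_loc_at R I \<subseteq> F.fracs I" unfolding max_loc_at_def
      using F.one_M by (intro L.genideal_minimal F.fracs_ideal is_ideal) (auto intro: F.fracsI)
    interpret J: ideal "Idl\<^bsub>F.L\<^esub> ?g" F.L by (rule L.genideal_ideal[OF sub])
    show "F.fracs I \<subseteq> max_loc_at R I"
    proof
      fix x assume "x \<in> F.fracs I"
      then obtain a s where x: "x = F.fract a s" "a \<in> I" "s \<in> carrier R - I" by (rule F.fracsE)
      have "F.fract a \<one> \<in> Idl\<^bsub>F.L\<^esub> ?g" using L.genideal_self[OF sub] x(2) by auto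
      then have "F.fract \<one> s \<otimes>\<^bsub>F.L\<^esub> F.fract a \<one> \<in> Idl\<^bsub>F.L\<^esub> ?g"
        using x by (intro J.I_l_closed) auto
      also have "F.fract \<one> s \<otimes>\<^bsub>F.L\<^esub> F.fract a \<one> = x"
        using x F.one_M Icarr by (auto simp: F.frac_mult)
      finally show "x \<in> max_loc_at R I" unfolding max_loc_at_def .
    qed
  qed
qed

lemma carrier_Quot: "carrier (A Quot I) = (\<lambda>a. I +>\<^bsub>A\<^esub> a) ` carrier A"
  by (auto simp: FactRing_def A_RCOSETS_def')

text \<open>
  The value of \<open>quot_map\<close> is the only element of a certain image set, so it is meaningful only once
  this set is known to be a singleton; that is where \<open>f ` I \<subseteq> J\<close> enters.
\<close>

lemma quot_map_coset:
  assumes f: "f \<in> ring_hom A B" and "ideal I A" "ideal J B" "f ` I \<subseteq> J" "a \<in> carrier A"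
  shows "quot_map B J f (I +>\<^bsub>A\<^esub> a) = J +>\<^bsub>B\<^esub> f a"
proof -
  interpret I: ideal I A by fact
  interpret J: ideal J B by fact
  have const: "J +>\<^bsub>B\<^esub> f x = J +>\<^bsub>B\<^esub> f a" if "x \<in> I +>\<^bsub>A\<^esub> a" for x
  proof -
    from that obtain i where i: "i \<in> I" "x = i \<oplus>\<^bsub>A\<^esub> a" unfolding a_r_coset_def' by auto
    have fx: "f x = f i \<oplus>\<^bsub>B\<^esub> f a" unfolding i(2)
      by (rule ring_hom_add[OF f I.Icarr[OF i(1)] assms(5)])
    have fi: "f i \<in> J" using i assms by auto
    note c = J.Icarr[OF fi] ring_hom_closed[OF f assms(5)]
    have "f x \<ominus>\<^bsub>B\<^esub> f a = f i" unfolding fx using c by (simp add: J.minus_eq J.a_assoc J.r_neg)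
    then show ?thesis
      using J.quotient_eq_iff_same_a_r_cos[OF assms(3), of "f x" "f a"] fi c unfolding fx by simp
  qed
  have "a \<in> I +>\<^bsub>A\<^esub> a" by (rule I.a_rcos_self[OF assms(5)])
  then have "(\<lambda>x. J +>\<^bsub>B\<^esub> f x) ` (I +>\<^bsub>A\<^esub> a) = {J +>\<^bsub>B\<^esub> f a}"
    by (subst image_cong[OF refl const]) auto
  then show ?thesis unfolding quot_map_def by simp
qed

context cring begin

context
  fixes T M N
  assumes T: "subring T R" and M: "fractions (R\<lparr>carrier := T\<rparr>) M" and N: "fractions R N"
    and MN: "M \<subseteq> N"
begin

interpretation F: fractions "R\<lparr>carrier := T\<rparr>" M by (rule M)
interpretation G: fractions R N by (rule N)

lemma loc_map_frac:
  assumes "a \<in> T" "s \<in> M"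
  shows "loc_map R N (F.fract a s) = G.fract a s"
proof -
  have "G.fract b t = G.fract a s" if "(b, t) \<in> F.fract a s" for b t
  proof -
    from that have bt: "b \<in> T" "t \<in> M" by (auto simp: F.mem_frac_iff)
    from that obtain u where "u \<in> M" "u \<otimes> (s \<otimes> b) = u \<otimes> (t \<otimes> a)"
      using F.frac_eq_iff[of b a t s] assms by (auto simp: F.mem_frac_iff)
    with bt assms MN subringE(1)[OF T] show ?thesis by (subst G.frac_eq_iff) auto
  qed
  then have "loc_map R N (F.fract a s) = (\<Union>p\<in>F.fract a s. G.fract a s)"
    unfolding loc_map_def by (intro SUP_cong refl) auto
  moreover have "(a, s) \<in> F.fract a s" using assms by (auto simp: F.mem_frac_iff)
  ultimately show ?thesis by auto
qed

lemma loc_map_hom: "loc_map R N \<in> ring_hom (localization (R\<lparr>carrier := T\<rparr>) M) (localization R N)"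
proof (rule ring_hom_memI)
  have c: "x \<in> carrier R" if "x \<in> T" for x using that subringE(1)[OF T] by auto
  have n: "x \<in> N" if "x \<in> M" for x using that MN by auto
  have m: "x \<in> T" if "x \<in> M" for x using that F.M_sub by auto
  fix x assume "x \<in> carrier F.L"
  then obtain a s where x: "x = F.fract a s" "a \<in> T" "s \<in> M" by (auto elim!: F.fracE)
  show "loc_map R N x \<in> carrier G.L" unfolding x(1) using x c n by (simp add: loc_map_frac)
  fix y assume "y \<in> carrier F.L"
  then obtain b t where y: "y = F.fract b t" "b \<in> T" "t \<in> M" by (auto elim!: F.fracE)
  note TE = subringE(6,7)[OF T]
  show "loc_map R N (x \<otimes>\<^bsub>F.L\<^esub> y) = loc_map R N x \<otimes>\<^bsub>G.L\<^esub> loc_map R N y"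
    using F.mult_M x y c n m TE by (simp add: F.frac_mult G.frac_mult loc_map_frac)
  show "loc_map R N (x \<oplus>\<^bsub>F.L\<^esub> y) = loc_map R N x \<oplus>\<^bsub>G.L\<^esub> loc_map R N y"
    using F.mult_M x y c n m TE by (simp add: F.frac_add G.frac_add loc_map_frac)
next
  show "loc_map R N \<one>\<^bsub>F.L\<^esub> = \<one>\<^bsub>G.L\<^esub>"
    using subringE(3)[OF T] F.one_M by (simp add: F.frac_one G.frac_one loc_map_frac)
qed

end

end

lemma (in cring) primeideal_contract:
  assumes T: "subring T R" and Q: "primeideal Q R"
  shows "primeideal (Q \<inter> T) (R\<lparr>carrier := T\<rparr>)"
proof -
  interpret Q: primeideal Q R by fact
  interpret T: cring "R\<lparr>carrier := T\<rparr>" by (rule subring_cring[OF T])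
  note TE = subringE[OF T]
  have c: "x \<in> carrier R" if "x \<in> T" for x using that TE(1) by auto
  show ?thesis
  proof (rule primeidealI)
    show "ideal (Q \<inter> T) (R\<lparr>carrier := T\<rparr>)"
      using TE(2,6,7) c Q.I_l_closed by (intro T.idealI_cring) auto
    show "cring (R\<lparr>carrier := T\<rparr>)" by (rule T.is_cring)
    show "carrier (R\<lparr>carrier := T\<rparr>) \<noteq> Q \<inter> T" using TE(3) Q.one_imp_carrier Q.I_notcarr by auto
  qed (use Q.I_prime c in auto)
qed

text \<open>
  Surjectivity of the residue field map at \<open>Q\<close>, with denominators cleared: \<open>x/1\<close> is congruent to
  some \<open>a/s\<close> modulo \<open>Q S\<^sub>Q\<close>, and primeness of \<open>Q\<close> brings \<open>s x - a\<close> back into \<open>Q\<close>.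
\<close>

lemma (in cring) infra_integral_residue:
  assumes T: "subring T R" and infra: "infra_integral_extension T R"
    and Q: "primeideal Q R" and x: "x \<in> carrier R"
  obtains a s where "a \<in> T" "s \<in> T" "s \<notin> Q" "s \<otimes> x \<ominus> a \<in> Q"
proof -
  interpret Q: primeideal Q R by fact
  let ?A = "R\<lparr>carrier := T\<rparr>" and ?P = "Q \<inter> T"
  interpret P: primeideal ?P ?A by (rule primeideal_contract[OF T Q])
  have M: "carrier ?A - ?P = T - Q" by auto
  interpret F: fractions ?A "T - Q" using P.fractions_compl unfolding M .
  interpret G: fractions R "carrier R - Q" by (rule Q.fractions_compl)
  interpret FL: cring F.L by (rule F.L_cring)
  interpret GL: cring G.L by (rule G.L_cring)
  have sub: "T - Q \<subseteq> carrier R - Q" using subringE(1)[OF T] by auto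
  have c: "y \<in> carrier R" if "y \<in> T" for y using that subringE(1)[OF T] by auto
  let ?f = "loc_map R (carrier R - Q)"
  note lm = loc_map_frac[OF T F.fractions_axioms G.fractions_axioms sub]
  have hom: "?f \<in> ring_hom F.L G.L"
    by (rule loc_map_hom[OF T F.fractions_axioms G.fractions_axioms sub])
  have mP: "max_loc_at ?A ?P = F.fracs ?P" using P.max_loc_at_eq unfolding M .
  have mQ: "max_loc_at R Q = G.fracs Q" by (rule Q.max_loc_at_eq)
  have iP: "ideal (F.fracs ?P) F.L" by (rule F.fracs_ideal[OF P.is_ideal])
  have iQ: "ideal (G.fracs Q) G.L" by (rule G.fracs_ideal[OF Q.is_ideal])
  have map: "?f ` F.fracs ?P \<subseteq> G.fracs Q"
    using sub by (auto elim!: F.fracsE simp: lm intro!: G.fracsI)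
  let ?g = "quot_map G.L (G.fracs Q) ?f"
  have "quot_map (loc_at R Q) (max_loc_at R Q) ?f
    \<in> ring_iso (loc_at ?A ?P Quot max_loc_at ?A ?P) (loc_at R Q Quot max_loc_at R Q)"
    using infra Q unfolding infra_integral_extension_def by blast
  then have "?g \<in> ring_iso (F.L Quot F.fracs ?P) (G.L Quot G.fracs Q)"
    unfolding mP mQ M .
  then have surj: "?g ` carrier (F.L Quot F.fracs ?P) = carrier (G.L Quot G.fracs Q)"
    by (auto simp: ring_iso_def bij_betw_def)
  have xL: "G.fract x \<one> \<in> carrier G.L" using x G.one_M by auto
  then have "G.fracs Q +>\<^bsub>G.L\<^esub> G.fract x \<one> \<in> carrier (G.L Quot G.fracs Q)"
    unfolding carrier_Quot by (rule imageI)
  then have "G.fracs Q +>\<^bsub>G.L\<^esub> G.fract x \<one> \<in> ?g ` (\<lambda>a. F.fracs ?P +>\<^bsub>F.L\<^esub> a) ` carrier F.L"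
    using surj unfolding carrier_Quot by blast
  then obtain y where y: "y \<in> carrier F.L"
      and "?g (F.fracs ?P +>\<^bsub>F.L\<^esub> y) = G.fracs Q +>\<^bsub>G.L\<^esub> G.fract x \<one>" by auto
  then have eq: "G.fracs Q +>\<^bsub>G.L\<^esub> ?f y = G.fracs Q +>\<^bsub>G.L\<^esub> G.fract x \<one>"
    using quot_map_coset[OF hom iP iQ map y] by simp
  from y obtain a s where as: "y = F.fract a s" "a \<in> T" "s \<in> T" "s \<notin> Q" by (auto elim!: F.fracE)
  then have s: "s \<in> carrier R - Q" using sub by auto
  have fy: "?f y = G.fract a s" using as by (simp add: lm)
  have aL: "G.fract a s \<in> carrier G.L" using s c as(2) by auto
  have "G.fract x \<one> \<ominus>\<^bsub>G.L\<^esub> G.fract a s \<in> G.fracs Q"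
    using eq GL.quotient_eq_iff_same_a_r_cos[OF iQ xL aL] unfolding fy by simp
  also have "G.fract x \<one> \<ominus>\<^bsub>G.L\<^esub> G.fract a s = G.fract (s \<otimes> x \<ominus> a) s"
    using x s as(2) c G.one_M by (simp add: a_minus_def G.frac_uminus G.frac_add)
  finally have "s \<otimes> x \<ominus> a \<in> Q"
    using G.frac_in_fracs_prime[OF Q, of "s \<otimes> x \<ominus> a" s] s x c[OF as(2)] by auto
  with that as show ?thesis by blast
qed

section \<open>A criterion for minimal decomposed extensions\<close>

lemma quot_map_ring_iso:
  assumes f: "f \<in> ring_hom A B" and I: "ideal I A" and J: "ideal J B" and sub: "f ` I \<subseteq> J"
    and inj: "\<And>a. a \<in> carrier A \<Longrightarrow> f a \<in> J \<Longrightarrow> a \<in> I"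
    and surj: "\<And>y. y \<in> carrier B \<Longrightarrow> \<exists>a\<in>carrier A. y \<ominus>\<^bsub>B\<^esub> f a \<in> J"
  shows "quot_map B J f \<in> ring_iso (A Quot I) (B Quot J)"
proof -
  interpret I: ideal I A by fact
  interpret J: ideal J B by fact
  interpret f: ring_hom_ring A B f by (rule ring_hom_ringI2[OF I.ring_axioms J.ring_axioms f])
  note coset = quot_map_coset[OF f I J sub]
  note pA = I.rcos_ring_hom and pB = J.rcos_ring_hom
  show ?thesis
  proof (rule ring_iso_memI)
    fix x assume "x \<in> carrier (A Quot I)"
    then obtain a where a: "x = I +>\<^bsub>A\<^esub> a" "a \<in> carrier A" by (auto simp: carrier_Quot)
    show "quot_map B J f x \<in> carrier (B Quot J)"
      using a by (simp add: coset carrier_Quot)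
    fix y assume "y \<in> carrier (A Quot I)"
    then obtain b where b: "y = I +>\<^bsub>A\<^esub> b" "b \<in> carrier A" by (auto simp: carrier_Quot)
    have "quot_map B J f (x \<otimes>\<^bsub>A Quot I\<^esub> y) = J +>\<^bsub>B\<^esub> (f a \<otimes>\<^bsub>B\<^esub> f b)"
      unfolding a(1) b(1) using a(2) b(2) by (simp add: ring_hom_mult[OF pA, symmetric] coset)
    also have "\<dots> = quot_map B J f x \<otimes>\<^bsub>B Quot J\<^esub> quot_map B J f y"
      unfolding a(1) b(1) using a(2) b(2) by (simp add: ring_hom_mult[OF pB] coset)
    finally show "quot_map B J f (x \<otimes>\<^bsub>A Quot I\<^esub> y)
      = quot_map B J f x \<otimes>\<^bsub>B Quot J\<^esub> quot_map B J f y" .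
    have "quot_map B J f (x \<oplus>\<^bsub>A Quot I\<^esub> y) = J +>\<^bsub>B\<^esub> (f a \<oplus>\<^bsub>B\<^esub> f b)"
      unfolding a(1) b(1) using a(2) b(2) by (simp add: ring_hom_add[OF pA, symmetric] coset)
    also have "\<dots> = quot_map B J f x \<oplus>\<^bsub>B Quot J\<^esub> quot_map B J f y"
      unfolding a(1) b(1) using a(2) b(2) by (simp add: ring_hom_add[OF pB] coset)
    finally show "quot_map B J f (x \<oplus>\<^bsub>A Quot I\<^esub> y)
      = quot_map B J f x \<oplus>\<^bsub>B Quot J\<^esub> quot_map B J f y" .
  next
    show "quot_map B J f \<one>\<^bsub>A Quot I\<^esub> = \<one>\<^bsub>B Quot J\<^esub>"
      by (simp add: ring_hom_one[OF pA, symmetric] ring_hom_one[OF pB, symmetric] coset)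
    have "inj_on (quot_map B J f) (carrier (A Quot I))"
    proof (rule inj_onI)
      fix x y assume "x \<in> carrier (A Quot I)" "y \<in> carrier (A Quot I)"
        and eq: "quot_map B J f x = quot_map B J f y"
      then obtain a b where ab: "x = I +>\<^bsub>A\<^esub> a" "a \<in> carrier A" "y = I +>\<^bsub>A\<^esub> b" "b \<in> carrier A"
        by (auto simp: carrier_Quot)
      then have "J +>\<^bsub>B\<^esub> f a = J +>\<^bsub>B\<^esub> f b" using eq by (simp add: coset)
      then have "f a \<ominus>\<^bsub>B\<^esub> f b \<in> J"
        using J.quotient_eq_iff_same_a_r_cos[OF J f.hom_closed f.hom_closed] ab by simp
      also have "f a \<ominus>\<^bsub>B\<^esub> f b = f (a \<ominus>\<^bsub>A\<^esub> b)" using ab by (simp add: a_minus_def)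
      finally have "a \<ominus>\<^bsub>A\<^esub> b \<in> I" using inj[of "a \<ominus>\<^bsub>A\<^esub> b"] ab by simp
      then show "x = y" using I.quotient_eq_iff_same_a_r_cos[OF I ab(2,4)] ab by simp
    qed
    moreover have "quot_map B J f ` carrier (A Quot I) = carrier (B Quot J)"
    proof
      show "quot_map B J f ` carrier (A Quot I) \<subseteq> carrier (B Quot J)"
        by (auto simp: carrier_Quot coset)
      show "carrier (B Quot J) \<subseteq> quot_map B J f ` carrier (A Quot I)"
      proof
        fix z assume "z \<in> carrier (B Quot J)"
        then obtain y where y: "z = J +>\<^bsub>B\<^esub> y" "y \<in> carrier B" by (auto simp: carrier_Quot)
        from surj[OF y(2)] obtain a where a: "a \<in> carrier A" "y \<ominus>\<^bsub>B\<^esub> f a \<in> J" by auto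
        then have "z = J +>\<^bsub>B\<^esub> f a"
          using J.quotient_eq_iff_same_a_r_cos[OF J y(2) f.hom_closed] y by simp
        also have "\<dots> = quot_map B J f (I +>\<^bsub>A\<^esub> a)" using a(1) by (simp add: coset)
        finally have "z = quot_map B J f (I +>\<^bsub>A\<^esub> a)" .
        moreover have "I +>\<^bsub>A\<^esub> a \<in> carrier (A Quot I)" unfolding carrier_Quot using a(1) by (rule imageI)
        ultimately show "z \<in> quot_map B J f ` carrier (A Quot I)" by (rule image_eqI)
      qed
    qed
    ultimately show "bij_betw (quot_map B J f) (carrier (A Quot I)) (carrier (B Quot J))"
      by (simp add: bij_betw_def)
  qed
qed

text \<open>
  With \<open>k = A/m\<close>, the hypotheses say that \<open>R/m\<close> is \<open>k \<times> k\<close> and that \<open>A\<close> is the preimage of the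
  diagonal. An \<open>x\<close> outside \<open>A\<close> has different residues \<open>a\<close> and \<open>b\<close> at \<open>M1\<close> and \<open>M2\<close>, so the affine
  functions of \<open>x\<close> over \<open>A\<close> interpolate any two prescribed residues and \<open>A[x] = R\<close>. Each \<open>y\<close> is
  integral because \<open>(y - p)(y - q)\<close> lies in \<open>M1 \<inter> M2 \<subseteq> A\<close> for suitable \<open>p\<close>, \<open>q\<close> in \<open>A\<close>.
\<close>

lemma (in cring) minimal_decomposedI:
  assumes A: "subring A R" and m: "maximalideal m (R\<lparr>carrier := A\<rparr>)"
    and M1: "ideal M1 R" and M2: "ideal M2 R" and ne: "M1 \<noteq> M2"
    and m1: "M1 \<inter> A = m" and m2: "M2 \<inter> A = m" and inter: "M1 \<inter> M2 \<subseteq> A"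
    and r1: "\<And>y. y \<in> carrier R \<Longrightarrow> \<exists>a\<in>A. y \<ominus> a \<in> M1"
    and r2: "\<And>y. y \<in> carrier R \<Longrightarrow> \<exists>a\<in>A. y \<ominus> a \<in> M2"
  shows "minimal_decomposed A R"
proof -
  let ?A = "R\<lparr>carrier := A\<rparr>"
  interpret M1: ideal M1 R by fact
  interpret M2: ideal M2 R by fact
  interpret A: cring ?A by (rule subring_cring[OF A])
  interpret m: maximalideal m ?A by fact
  note AE = subringE[OF A]
  have c: "x \<in> carrier R" if "x \<in> A" for x using that AE(1) by auto
  have mA: "x \<in> A" if "x \<in> m" for x using m.Icarr[OF that] by simp
  have mM: "m = M1 \<inter> M2" using m1 m2 inter by auto
  have one: "\<one> \<notin> m" using m.one_imp_carrier m.I_notcarr by auto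
  have AR: "A \<noteq> carrier R" using m1 m2 ne M1.Icarr M2.Icarr by blast
  have inv: "\<exists>i\<in>m. \<exists>u\<in>A. i \<oplus> u \<otimes> a = \<one>" if "a \<in> A" "a \<notin> m" for a
    by (rule A.inverse_mod_maximalideal[OF m, of a]) (use that in auto)
  have minus: "x \<ominus> y \<in> A" if "x \<in> A" "y \<in> A" for x y using that AE by (simp add: a_minus_def)

  have conductor: "ext_conductor A R = m"
  proof
    have "x \<otimes> s \<in> A" if "x \<in> m" "s \<in> carrier R" for x s
      using that mM M1.I_r_closed M2.I_r_closed inter by blast
    then show "m \<subseteq> ext_conductor A R" using mA by (auto simp: ext_conductor_def)
    show "ext_conductor A R \<subseteq> m"
    proof
      fix x assume "x \<in> ext_conductor A R"
      then have x: "x \<in> A" "\<And>s. s \<in> carrier R \<Longrightarrow> x \<otimes> s \<in> A" by (auto simp: ext_conductor_def)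
      show "x \<in> m"
      proof (rule ccontr)
        assume "x \<notin> m"
        with inv x obtain i u where iu: "i \<in> m" "u \<in> A" "i \<oplus> u \<otimes> x = \<one>" by blast
        have "y \<in> A" if y: "y \<in> carrier R" for y
        proof -
          have "y = (i \<oplus> u \<otimes> x) \<otimes> y" using iu y by simp
          also have "\<dots> = i \<otimes> y \<oplus> u \<otimes> (x \<otimes> y)" using c[OF mA[OF iu(1)]] c[OF iu(2)] c[OF x(1)] y by algebra
          also have "\<dots> \<in> A" using \<open>\<And>x s. x \<in> m \<Longrightarrow> s \<in> carrier R \<Longrightarrow> x \<otimes> s \<in> A\<close>[OF iu(1) y] x(2)[OF y] iu(2) AE by simp
          finally show ?thesis .
        qed
        then show False using AR AE(1) by blast
      qed
    qed
  qed

  have gen: "T = carrier R" if T: "subring T R" "A \<subseteq> T" "T \<noteq> A" for T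
  proof -
    note TE = subringE[OF T(1)]
    from T(2,3) obtain x where x: "x \<in> T" "x \<notin> A" by blast
    have xc: "x \<in> carrier R" using x TE(1) by auto
    from r1[OF xc] obtain a where a: "a \<in> A" "x \<ominus> a \<in> M1" by blast
    from r2[OF xc] obtain b where b: "b \<in> A" "x \<ominus> b \<in> M2" by blast
    note ac = c[OF a(1)] and bc = c[OF b(1)]
    have "a \<ominus> b \<notin> m"
    proof
      assume "a \<ominus> b \<in> m"
      then have "(x \<ominus> b) \<ominus> (a \<ominus> b) \<in> M2" using mM b by (simp add: a_minus_def)
      also have "(x \<ominus> b) \<ominus> (a \<ominus> b) = x \<ominus> a" using xc ac bc by algebra
      finally have "x \<ominus> a \<in> A" using a inter by auto
      then have "(x \<ominus> a) \<oplus> a \<in> A" using a AE by simp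
      also have "(x \<ominus> a) \<oplus> a = x" using xc ac by algebra
      finally show False using x by simp
    qed
    then obtain i u where iu: "i \<in> m" "u \<in> A" "i \<oplus> u \<otimes> (a \<ominus> b) = \<one>"
      using inv minus a b by blast
    have "y \<in> T" if y: "y \<in> carrier R" for y
    proof -
      from r1[OF y] obtain p where p: "p \<in> A" "y \<ominus> p \<in> M1" by blast
      from r2[OF y] obtain q where q: "q \<in> A" "y \<ominus> q \<in> M2" by blast
      note pc = c[OF p(1)] and qc = c[OF q(1)]
      note cc = xc ac bc pc qc y
      \<comment> \<open>Interpolation: \<open>?t\<close> has the residues \<open>(a - b) p\<close> and \<open>(a - b) q\<close>, as \<open>(a - b) y\<close> has.\<close>
      let ?t = "(p \<ominus> q) \<otimes> x \<oplus> (a \<otimes> q \<ominus> b \<otimes> p)"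
      let ?w = "(a \<ominus> b) \<otimes> y \<ominus> ?t"
      have "?w = (a \<ominus> b) \<otimes> (y \<ominus> p) \<ominus> (p \<ominus> q) \<otimes> (x \<ominus> a)" using cc by algebra
      also have "\<dots> \<in> M1" using cc a(2) p(2) by (simp add: a_minus_def M1.I_l_closed)
      finally have w1: "?w \<in> M1" .
      have "?w = (a \<ominus> b) \<otimes> (y \<ominus> q) \<ominus> (p \<ominus> q) \<otimes> (x \<ominus> b)" using cc by algebra
      also have "\<dots> \<in> M2" using cc b(2) q(2) by (simp add: a_minus_def M2.I_l_closed)
      finally have w: "?w \<in> A" using w1 inter by blast
      have "p \<ominus> q \<in> A" "a \<otimes> q \<ominus> b \<otimes> p \<in> A"
        using minus[OF p(1) q(1)] minus[OF AE(6)[OF a(1) q(1)] AE(6)[OF b(1) p(1)]] by auto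
      then have "p \<ominus> q \<in> T" "a \<otimes> q \<ominus> b \<otimes> p \<in> T" using T(2) by auto
      then have t: "?t \<in> T" by (rule TE(7)[OF TE(6)[OF _ x(1)]])
      have "?w \<oplus> ?t \<in> T" using w t T(2) TE(7) by blast
      also have "?w \<oplus> ?t = (a \<ominus> b) \<otimes> y" using cc by algebra
      finally have wT: "(a \<ominus> b) \<otimes> y \<in> T" .
      \<comment> \<open>Divide by \<open>a - b\<close>, a unit modulo \<open>m\<close>; the error \<open>i y\<close> lies in \<open>m\<close>, hence in \<open>A\<close>.\<close>
      have "y = (i \<oplus> u \<otimes> (a \<ominus> b)) \<otimes> y" using iu y by simp
      also have "\<dots> = i \<otimes> y \<oplus> u \<otimes> ((a \<ominus> b) \<otimes> y)" using c[OF mA[OF iu(1)]] c[OF iu(2)] cc by algebra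
      also have "\<dots> \<in> T"
      proof -
        have "i \<otimes> y \<in> A" using iu(1) y mM M1.I_r_closed M2.I_r_closed inter by blast
        then show ?thesis using wT iu(2) T(2) TE(6,7) by blast
      qed
      finally show ?thesis .
    qed
    then show ?thesis using TE(1) by blast
  qed

  have "integral_extension A R"
    unfolding integral_extension_def ring_extension_def
  proof (intro conjI ballI A is_cring)
    fix y assume y: "y \<in> carrier R"
    from r1[OF y] obtain p where p: "p \<in> A" "y \<ominus> p \<in> M1" by blast
    from r2[OF y] obtain q where q: "q \<in> A" "y \<ominus> q \<in> M2" by blast
    note cc = y c[OF p(1)] c[OF q(1)]
    let ?e = "(y \<ominus> p) \<otimes> (y \<ominus> q)"
    have e: "?e \<in> A" using M1.I_r_closed[OF p(2), of "y \<ominus> q"] M2.I_l_closed[OF q(2), of "y \<ominus> p"] cc inter by auto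
    \<comment> \<open>The monic quadratic \<open>(Y - p)(Y - q) - e\<close>, vanishing at \<open>y\<close>.\<close>
    let ?b = "\<ominus> (p \<oplus> q)" and ?c = "p \<otimes> q \<ominus> ?e"
    have "eval [\<one>, ?b, ?c] y = \<one> \<otimes> (y \<otimes> y) \<oplus> (?b \<otimes> y \<oplus> ?c)"
      using cc by (simp add: numeral_2_eq_2)
    also have "\<dots> = \<zero>" using cc by algebra
    finally have "eval [\<one>, ?b, ?c] y = \<zero>" .
    moreover have "set [?b, ?c] \<subseteq> A" using e p q AE minus by simp
    ultimately show "\<exists>ps. set ps \<subseteq> A \<and> eval (\<one> # ps) y = \<zero>" by blast
  qed
  moreover have "minimal_extension A R"
    using gen A AR is_cring carrier_is_subring AE(1)
    unfolding minimal_extension_def ring_extension_def intermediate_rings_def by blast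
  moreover have "maximalideal M R"
    if M: "ideal M R" and mm: "M \<inter> A = m" and r: "\<And>y. y \<in> carrier R \<Longrightarrow> \<exists>a\<in>A. y \<ominus> a \<in> M" for M
  proof (rule maximalidealI)
    interpret M: ideal M R by fact
    show "ideal M R" by fact
    show "carrier R \<noteq> M" using one mm AE(3) by auto
    fix J assume J: "ideal J R" "M \<subseteq> J" "J \<subseteq> carrier R"
    interpret J: ideal J R by fact
    show "J = M \<or> J = carrier R"
    proof (rule disjCI)
      assume "J \<noteq> carrier R"
      have "y \<in> M" if y: "y \<in> J" for y
      proof (rule ccontr)
        assume yM: "y \<notin> M"
        have yc: "y \<in> carrier R" using J.Icarr[OF y] .
        from r[OF yc] obtain a where a: "a \<in> A" "y \<ominus> a \<in> M" by blast
        have "y \<ominus> (y \<ominus> a) \<in> J" using y a J by (auto simp: a_minus_def)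
        also have "y \<ominus> (y \<ominus> a) = a" using yc c[OF a(1)] by algebra
        finally have aJ: "a \<in> J" .
        have "a \<notin> m"
        proof
          assume "a \<in> m"
          then have "(y \<ominus> a) \<oplus> a \<in> M" using a mm by auto
          also have "(y \<ominus> a) \<oplus> a = y" using yc c[OF a(1)] by algebra
          finally show False using yM by simp
        qed
        with inv a obtain i u where iu: "i \<in> m" "u \<in> A" "i \<oplus> u \<otimes> a = \<one>" by blast
        have "i \<in> J" using iu mm J by auto
        then have "i \<oplus> u \<otimes> a \<in> J" using J.I_l_closed[OF aJ c[OF iu(2)]] by simp
        then show False using iu J.one_imp_carrier \<open>J \<noteq> carrier R\<close> by simp
      qed
      then show "J = M" using J by blast
    qed
  qed
  moreover have "quot_map R M (\<lambda>x. x) \<in> ring_iso (?A Quot m) (R Quot M)"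
    if M: "ideal M R" and mm: "M \<inter> A = m" and r: "\<And>y. y \<in> carrier R \<Longrightarrow> \<exists>a\<in>A. y \<ominus> a \<in> M" for M
  proof (rule quot_map_ring_iso[OF _ m.is_ideal M])
    show "(\<lambda>x. x) \<in> ring_hom ?A R" using c by (intro ring_hom_memI) auto
  qed (use mm r in auto)
  ultimately show ?thesis
    unfolding minimal_decomposed_def conductor using m M1 M2 m1 m2 r1 r2 ne mM by blast
qed

section \<open>Intermediate rings and their localizations\<close>

locale subring_pair = cring S for S (structure) + fixes R
  assumes R: "subring R S"
begin

abbreviation "RR \<equiv> S\<lparr>carrier := R\<rparr>"

sublocale RR: cring RR by (rule subring_cring[OF R])

lemma R_carr: "x \<in> R \<Longrightarrow> x \<in> carrier S" using subringE(1)[OF R] by auto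

text \<open>
  The preimage of \<open>T\<^sub>P\<close> under \<open>S \<rightarrow> S\<^sub>P\<close>. Working with this subset of \<open>S\<close> lets localizations of
  different intermediate rings, at different primes, be compared and intersected inside \<open>S\<close>.
\<close>

definition sat :: "'a set \<Rightarrow> 'a set \<Rightarrow> 'a set" where
  "sat P T = {x \<in> carrier S. \<exists>s\<in>R - P. s \<otimes> x \<in> T}"

lemma satI: "x \<in> carrier S \<Longrightarrow> s \<in> R - P \<Longrightarrow> s \<otimes> x \<in> T \<Longrightarrow> x \<in> sat P T"
  by (auto simp: sat_def)

lemma satE:
  assumes "x \<in> sat P T" obtains s where "x \<in> carrier S" "s \<in> R" "s \<notin> P" "s \<otimes> x \<in> T"
  using assms by (auto simp: sat_def)

lemma sat_subset: "sat P T \<subseteq> carrier S" by (auto simp: sat_def)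

lemma sat_mono: "T \<subseteq> U \<Longrightarrow> sat P T \<subseteq> sat P U" by (auto simp: sat_def)

lemma intermediateE:
  assumes "T \<in> intermediate_rings R S" shows "subring T S" "R \<subseteq> T" "T \<subseteq> carrier S"
  using assms subringE(1)[of T S] by (auto simp: intermediate_rings_def)

lemma R_intermediate: "R \<in> intermediate_rings R S"
  using R by (auto simp: intermediate_rings_def)

lemma compl_closed:
  assumes "primeideal P RR" shows "\<one> \<in> R - P" "\<And>s t. s \<in> R - P \<Longrightarrow> t \<in> R - P \<Longrightarrow> s \<otimes> t \<in> R - P"
proof -
  interpret P: primeideal P RR by fact
  interpret F: fractions RR "carrier RR - P" by (rule P.fractions_compl)
  show "\<one> \<in> R - P" using F.one_M by simp
  show "s \<otimes> t \<in> R - P" if "s \<in> R - P" "t \<in> R - P" for s t using F.mult_M[of s t] that by simp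
qed

lemma fractions_RR: "primeideal P RR \<Longrightarrow> fractions RR (R - P)"
  using primeideal.fractions_compl[of P RR] by simp

lemma fractions_S: "primeideal P RR \<Longrightarrow> fractions S (R - P)"
  using compl_closed[of P] R_carr by unfold_locales auto

lemma sat_incr: "primeideal P RR \<Longrightarrow> T \<in> intermediate_rings R S \<Longrightarrow> T \<subseteq> sat P T"
  using compl_closed(1)[of P] intermediateE(3)[of T] by (auto simp: sat_def intro!: bexI[of _ \<one>])

lemma sat_subring:
  assumes P: "primeideal P RR" and T: "T \<in> intermediate_rings R S"
  shows "sat P T \<in> intermediate_rings R S"
proof -
  note TE = subringE[OF intermediateE(1)[OF T]]
  have RT: "x \<in> T" if "x \<in> R" for x using that intermediateE[OF T] by auto
  have "subring (sat P T) S"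
  proof (rule subringI)
    show "sat P T \<subseteq> carrier S" by (rule sat_subset)
    show "\<one> \<in> sat P T" using sat_incr[OF P T] TE by auto
    fix x assume "x \<in> sat P T"
    then obtain s where x: "x \<in> carrier S" "s \<in> R" "s \<notin> P" "s \<otimes> x \<in> T" by (rule satE)
    have "s \<otimes> (\<ominus> x) \<in> T" using x R_carr TE by (simp add: r_minus)
    then show "\<ominus> x \<in> sat P T" using x by (auto simp: sat_def)
    fix y assume "y \<in> sat P T"
    then obtain t where y: "y \<in> carrier S" "t \<in> R" "t \<notin> P" "t \<otimes> y \<in> T" by (rule satE)
    note c = x(1) y(1) R_carr[OF x(2)] R_carr[OF y(2)]
    have st: "s \<otimes> t \<in> R - P" using compl_closed(2)[OF P] x y by auto
    have "(s \<otimes> x) \<otimes> (t \<otimes> y) \<in> T" using TE x y by auto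
    also have "(s \<otimes> x) \<otimes> (t \<otimes> y) = (s \<otimes> t) \<otimes> (x \<otimes> y)" using c by algebra
    finally show "x \<otimes> y \<in> sat P T" using c by (intro satI[OF _ st]) auto
    have "t \<otimes> (s \<otimes> x) \<oplus> s \<otimes> (t \<otimes> y) \<in> T" using TE(6,7) x y RT by auto
    also have "t \<otimes> (s \<otimes> x) \<oplus> s \<otimes> (t \<otimes> y) = (s \<otimes> t) \<otimes> (x \<oplus> y)" using c by algebra
    finally show "x \<oplus> y \<in> sat P T" using c by (intro satI[OF _ st]) auto
  qed
  then show ?thesis using sat_incr[OF P T] intermediateE(2)[OF T] by (auto simp: intermediate_rings_def)
qed

lemma sat_Int:
  assumes P: "primeideal P RR" and T: "T \<in> intermediate_rings R S" and U: "U \<in> intermediate_rings R S"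
  shows "sat P T \<inter> sat P U \<subseteq> sat P (T \<inter> U)"
proof
  note TE = subringE[OF intermediateE(1)[OF T]] and UE = subringE[OF intermediateE(1)[OF U]]
  fix x assume "x \<in> sat P T \<inter> sat P U"
  then obtain s t where x: "x \<in> carrier S" "s \<in> R" "s \<notin> P" "s \<otimes> x \<in> T" "t \<in> R" "t \<notin> P" "t \<otimes> x \<in> U"
    by (auto simp: sat_def)
  note c = x(1) R_carr[OF x(2)] R_carr[OF x(5)]
  have "t \<otimes> (s \<otimes> x) \<in> T" using x TE(6) intermediateE(2)[OF T] by blast
  moreover have "s \<otimes> (t \<otimes> x) \<in> U" using x UE(6) intermediateE(2)[OF U] by blast
  moreover have "t \<otimes> (s \<otimes> x) = (s \<otimes> t) \<otimes> x" "s \<otimes> (t \<otimes> x) = (s \<otimes> t) \<otimes> x" using c by algebra+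
  ultimately have "(s \<otimes> t) \<otimes> x \<in> T \<inter> U" by simp
  then show "x \<in> sat P (T \<inter> U)" using x compl_closed(2)[OF P] by (intro satI[of x "s \<otimes> t"]) auto
qed

text \<open>
  The \<open>r \<in> R\<close> with \<open>r x \<in> T\<close> form an ideal. If \<open>1\<close> is not in it, it lies in a prime \<open>P\<close>, and then
  \<open>x\<close> is not in \<open>T\<^sub>P\<close>.
\<close>

lemma sat_local:
  assumes T: "T \<in> intermediate_rings R S" and x: "x \<in> carrier S"
    and loc: "\<And>P. primeideal P RR \<Longrightarrow> x \<in> sat P T"
  shows "x \<in> T"
proof (rule ccontr)
  assume xT: "x \<notin> T"
  note TE = subringE[OF intermediateE(1)[OF T]]
  let ?J = "{r \<in> R. r \<otimes> x \<in> T}"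
  have "ideal ?J RR"
  proof (rule RR.idealI_cring)
    fix r s assume "r \<in> ?J" "s \<in> ?J"
    then show "r \<oplus>\<^bsub>RR\<^esub> s \<in> ?J" using R_carr x TE(7) subringE(7)[OF R] by (simp add: l_distr)
  next
    fix r s assume "r \<in> carrier RR" "s \<in> ?J"
    then show "r \<otimes>\<^bsub>RR\<^esub> s \<in> ?J" using R_carr x TE(6) subringE(6)[OF R] intermediateE(2)[OF T]
      by (auto simp: m_assoc)
  qed (use x TE subringE(2)[OF R] in auto)
  moreover have "?J \<inter> {\<one>} = {}" using xT x by auto
  ultimately obtain P where P: "primeideal P RR" "?J \<subseteq> P"
    using RR.exists_prime_avoiding[of ?J "{\<one>}"] subringE(3)[OF R] by auto
  from loc[OF P(1)] P(2) show False by (auto simp: sat_def)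
qed

lemma ext_loc_base_eq:
  assumes P: "primeideal P RR"
  shows "ext_loc_base R S P = fractions.fracs S (R - P) R"
proof -
  interpret F: fractions RR "R - P" by (rule fractions_RR[OF P])
  interpret G: fractions S "R - P" by (rule fractions_S[OF P])
  note lm = loc_map_frac[OF R F.fractions_axioms G.fractions_axioms subset_refl]
  show ?thesis
  proof
    show "ext_loc_base R S P \<subseteq> G.fracs R"
      unfolding ext_loc_base_def by (auto elim!: F.fracE simp: lm intro!: G.fracsI)
    show "G.fracs R \<subseteq> ext_loc_base R S P"
    proof
      fix x assume "x \<in> G.fracs R"
      then obtain a s where x: "x = G.fract a s" "a \<in> R" "s \<in> R - P" by (rule G.fracsE)
      have "x = loc_map S (R - P) (F.fract a s)" using x by (simp add: lm)
      moreover have "F.fract a s \<in> carrier F.L" using x by (intro F.frac_carrier) auto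
      ultimately show "x \<in> ext_loc_base R S P" unfolding ext_loc_base_def by auto
    qed
  qed
qed

lemma frac_in_fracs_sat:
  assumes P: "primeideal P RR" and T: "T \<in> intermediate_rings R S"
    and x: "x \<in> carrier S" and s: "s \<in> R - P"
  shows "loc_frac S (R - P) x s \<in> fractions.fracs S (R - P) T \<longleftrightarrow> x \<in> sat P T"
proof -
  interpret G: fractions S "R - P" by (rule fractions_S[OF P])
  note TE = subringE[OF intermediateE(1)[OF T]]
  have RT: "x \<in> T" if "x \<in> R" for x using that intermediateE[OF T] by auto
  show ?thesis
  proof
    assume "G.fract x s \<in> G.fracs T"
    then obtain a t where a: "G.fract x s = G.fract a t" "a \<in> T" "t \<in> R - P" by (rule G.fracsE)
    have ac: "a \<in> carrier S" using a TE by auto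
    from a(1) obtain u where u: "u \<in> R - P" "u \<otimes> (t \<otimes> x) = u \<otimes> (s \<otimes> a)"
      using G.frac_eq_iff[OF x ac s a(3)] by auto
    have "u \<otimes> (s \<otimes> a) \<in> T" using u(1) s a TE(6) RT by auto
    then have "(u \<otimes> t) \<otimes> x \<in> T" using u a(3) x by (simp add: m_assoc R_carr)
    then show "x \<in> sat P T" using G.mult_M[OF u(1) a(3)] x by (intro satI)
  next
    assume "x \<in> sat P T"
    then obtain w where w: "w \<in> R" "w \<notin> P" "w \<otimes> x \<in> T" by (rule satE)
    have ws: "w \<otimes> s \<in> R - P" using w s G.mult_M by auto
    have "G.fract x s = G.fract (w \<otimes> x) (w \<otimes> s)"
      using ws w s x R_carr by (intro G.frac_eqI) (auto simp: m_assoc m_lcomm)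
    then show "G.fract x s \<in> G.fracs T" using w ws by (simp add: G.fracsI)
  qed
qed

lemma ext_supp_iff: "P \<in> ext_supp R S \<longleftrightarrow> primeideal P RR \<and> sat P R \<noteq> carrier S"
proof (cases "primeideal P RR")
  case True
  interpret G: fractions S "R - P" by (rule fractions_S[OF True])
  note fr = frac_in_fracs_sat[OF True R_intermediate]
  have "G.fracs R = carrier G.L \<longleftrightarrow> sat P R = carrier S"
  proof
    assume eq: "G.fracs R = carrier G.L"
    have "x \<in> sat P R" if "x \<in> carrier S" for x
      using fr[OF that G.one_M] eq that G.one_M by auto
    then show "sat P R = carrier S" using sat_subset by blast
  next
    assume eq: "sat P R = carrier S"
    have "y \<in> G.fracs R" if "y \<in> carrier G.L" for y
    proof -
      from that obtain x s where "y = G.fract x s" "x \<in> carrier S" "s \<in> R - P" by (rule G.fracE)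
      then show ?thesis using fr eq by simp
    qed
    then show "G.fracs R = carrier G.L" using R_carr by (auto elim!: G.fracsE)
  qed
  then show ?thesis using True ext_loc_base_eq[OF True] by (auto simp: ext_supp_def ext_loc_top_def)
next
  case False
  then show ?thesis by (auto simp: ext_supp_def)
qed

text \<open>
  On the support this is minimality of \<open>R\<^sub>P \<subseteq> S\<^sub>P\<close> applied to \<open>T\<^sub>P\<close>; off the support both
  alternatives hold.
\<close>

lemma sat_dichotomy:
  assumes lm: "locally_minimal_decomposed R S" and P: "primeideal P RR" and T: "T \<in> intermediate_rings R S"
  shows "sat P T = sat P R \<or> sat P T = carrier S"
proof (cases "P \<in> ext_supp R S")
  case False
  then have "sat P R = carrier S" using P ext_supp_iff by auto
  then show ?thesis using sat_mono[OF intermediateE(2)[OF T], of P] sat_subset by blast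
next
  case True
  interpret G: fractions S "R - P" by (rule fractions_S[OF P])
  have "minimal_decomposed (ext_loc_base R S P) (ext_loc_top R S P)"
    using lm True by (simp add: locally_minimal_decomposed_def)
  then have min: "intermediate_rings (G.fracs R) G.L = {G.fracs R, carrier G.L}"
    by (simp add: minimal_decomposed_def minimal_extension_def ext_loc_base_eq[OF P] ext_loc_top_def)
  have "subring (G.fracs T) G.L"
    using intermediateE[OF T] by (intro G.fracs_subring) auto
  moreover have "G.fracs R \<subseteq> G.fracs T" using intermediateE(2)[OF T] by (auto simp: G.fracs_def)
  ultimately have "G.fracs T \<in> {G.fracs R, carrier G.L}"
    unfolding min[symmetric] by (simp add: intermediate_rings_def)
  then have cases: "G.fracs T = G.fracs R \<or> G.fracs T = carrier G.L" by simp
  have eq: "sat P U = {x \<in> carrier S. G.fract x \<one> \<in> G.fracs U}" if "U \<in> intermediate_rings R S" for U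
    using frac_in_fracs_sat[OF P that _ G.one_M] sat_subset[of P U] by auto
  have "{x \<in> carrier S. G.fract x \<one> \<in> carrier G.L} = carrier S" using G.one_M by auto
  then show ?thesis using cases unfolding eq[OF T] eq[OF R_intermediate] by auto
qed

lemma compositum_intermediate:
  assumes "T \<in> intermediate_rings R S" "U \<in> intermediate_rings R S"
  shows "compositum S T U \<in> intermediate_rings R S" "T \<subseteq> compositum S T U" "U \<subseteq> compositum S T U"
    "\<And>V. V \<in> intermediate_rings R S \<Longrightarrow> T \<subseteq> V \<Longrightarrow> U \<subseteq> V \<Longrightarrow> compositum S T U \<subseteq> V"
proof -
  have c: "T \<union> U \<subseteq> carrier S" using assms intermediateE(3) by auto
  show "T \<subseteq> compositum S T U" "U \<subseteq> compositum S T U"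
    by (auto simp: compositum_def intro: generate_ring.incl)
  then show "compositum S T U \<in> intermediate_rings R S"
    using generate_ring_is_subring[OF c] intermediateE(2)[OF assms(1)]
    by (auto simp: intermediate_rings_def compositum_def)
  show "compositum S T U \<subseteq> V" if "V \<in> intermediate_rings R S" "T \<subseteq> V" "U \<subseteq> V" for V
    unfolding compositum_def using that intermediateE(1)[OF that(1)]
    by (intro generate_ring_min_subring1[OF c]) auto
qed

lemma Int_intermediate:
  "T \<in> intermediate_rings R S \<Longrightarrow> U \<in> intermediate_rings R S \<Longrightarrow> T \<inter> U \<in> intermediate_rings R S"
  using subring_inter by (auto simp: intermediate_rings_def)

text \<open>
  It suffices to check \<open>T \<inter> UV \<subseteq> (T \<inter> U)(T \<inter> V)\<close> at each \<open>P\<close>, where \<open>T\<close>, \<open>U\<close> and \<open>V\<close> each localize to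
  \<open>R\<^sub>P\<close> or \<open>S\<^sub>P\<close>. If \<open>T\<^sub>P = R\<^sub>P\<close>, or \<open>U\<^sub>P = V\<^sub>P = R\<^sub>P\<close>, the left side is already in \<open>R\<^sub>P\<close>; otherwise
  \<open>T \<inter> U\<close> or \<open>T \<inter> V\<close> localizes to \<open>S\<^sub>P\<close>.
\<close>

lemma distributive_if_locally_minimal:
  assumes lm: "locally_minimal_decomposed R S"
  shows "distributive_extension R S"
  unfolding distributive_extension_def
proof (intro ballI)
  fix T U V assume T: "T \<in> intermediate_rings R S" and U: "U \<in> intermediate_rings R S"
    and V: "V \<in> intermediate_rings R S"
  note TU = Int_intermediate[OF T U] and TV = Int_intermediate[OF T V]
  let ?W = "compositum S (T \<inter> U) (T \<inter> V)"
  note UV = compositum_intermediate[OF U V] and W = compositum_intermediate[OF TU TV]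
  show "T \<inter> compositum S U V = ?W"
  proof
    have "T \<inter> U \<subseteq> T \<inter> compositum S U V" "T \<inter> V \<subseteq> T \<inter> compositum S U V" using UV by auto
    then show "?W \<subseteq> T \<inter> compositum S U V" by (rule W(4)[OF Int_intermediate[OF T UV(1)]])
    show "T \<inter> compositum S U V \<subseteq> ?W"
    proof
      fix x assume x: "x \<in> T \<inter> compositum S U V"
      have xc: "x \<in> carrier S" using x intermediateE(3)[OF T] by auto
      show "x \<in> ?W"
      proof (rule sat_local[OF W(1) xc])
        fix P assume P: "primeideal P RR"
        note dich = sat_dichotomy[OF lm P]
        note RW = sat_mono[OF intermediateE(2)[OF W(1)], of P]
        show "x \<in> sat P ?W"
        proof (cases "sat P T = sat P R")
          case True
          then show ?thesis using x sat_incr[OF P T] RW by auto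
        next
          case False
          then have TS: "sat P T = carrier S" using dich[OF T] by auto
          show ?thesis
          proof (cases "sat P U = sat P R \<and> sat P V = sat P R")
            case True
            then have "U \<subseteq> sat P R" "V \<subseteq> sat P R" using sat_incr[OF P] U V by auto
            then have "compositum S U V \<subseteq> sat P R" by (rule UV(4)[OF sat_subring[OF P R_intermediate]])
            then show ?thesis using x RW by auto
          next
            case False
            then have "sat P U = carrier S \<or> sat P V = carrier S" using dich[OF U] dich[OF V] by auto
            then have "carrier S \<subseteq> sat P (T \<inter> U) \<or> carrier S \<subseteq> sat P (T \<inter> V)"
              using sat_Int[OF P T U] sat_Int[OF P T V] TS by auto
            then show ?thesis using xc sat_mono[OF W(2), of P] sat_mono[OF W(3), of P] by auto
          qed
        qed
      qed
    qed
  qed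
qed

text \<open>
  The map sending \<open>T\<close> to the primes of the support at which \<open>T\<^sub>P = S\<^sub>P\<close> is injective.
\<close>

lemma finite_intermediate_rings:
  assumes lm: "locally_minimal_decomposed R S" and fin: "finite (ext_supp R S)"
  shows "finite (intermediate_rings R S)"
proof (rule finite_imageD)
  let ?h = "\<lambda>T. {P \<in> ext_supp R S. sat P T = carrier S}"
  show "finite (?h ` intermediate_rings R S)"
    by (rule finite_subset[of _ "Pow (ext_supp R S)"]) (use fin in auto)
  have sub: "T \<subseteq> U" if T: "T \<in> intermediate_rings R S" and U: "U \<in> intermediate_rings R S"
    and eq: "?h T = ?h U" for T U
  proof
    fix x assume x: "x \<in> T"
    then have xc: "x \<in> carrier S" using intermediateE(3)[OF T] by auto
    show "x \<in> U"
    proof (rule sat_local[OF U xc])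
      fix P assume P: "primeideal P RR"
      have RU: "sat P R \<subseteq> sat P U" by (rule sat_mono[OF intermediateE(2)[OF U]])
      show "x \<in> sat P U"
      proof (cases "P \<in> ext_supp R S \<and> sat P T = carrier S")
        case True
        then have "P \<in> ?h U" unfolding eq[symmetric] by simp
        then show ?thesis using xc by auto
      next
        case False
        then have "sat P T \<subseteq> sat P R"
          using sat_dichotomy[OF lm P T] P ext_supp_iff sat_subset by auto
        then show ?thesis using RU x sat_incr[OF P T] by auto
      qed
    qed
  qed
  show "inj_on ?h (intermediate_rings R S)"
    by (intro inj_onI equalityI sub) auto
qed

end

section \<open>Seminormal extensions and locally maximal conductors\<close>

lemma (in subring_pair) conductorD:
  assumes "x \<in> ext_conductor R S" shows "x \<in> R" "\<And>s. s \<in> carrier S \<Longrightarrow> x \<otimes> s \<in> R"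
  using assms by (auto simp: ext_conductor_def)

lemma (in subring_pair) conductor_ideal: "ideal (ext_conductor R S) S"
proof (rule idealI_cring)
  note RE = subringE[OF R]
  show "ext_conductor R S \<subseteq> carrier S" using R_carr by (auto simp: ext_conductor_def)
  show "\<zero> \<in> ext_conductor R S" using RE by (auto simp: ext_conductor_def)
  show "x \<oplus> y \<in> ext_conductor R S" if "x \<in> ext_conductor R S" "y \<in> ext_conductor R S" for x y
    using that RE(7) R_carr by (auto simp: ext_conductor_def l_distr)
  fix r x assume r: "r \<in> carrier S" and "x \<in> ext_conductor R S"
  then have x: "x \<in> carrier S" "\<And>s. s \<in> carrier S \<Longrightarrow> x \<otimes> s \<in> R"
    using R_carr by (auto simp: ext_conductor_def)
  have "(r \<otimes> x) \<otimes> s \<in> R" if s: "s \<in> carrier S" for s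
  proof -
    have "x \<otimes> (r \<otimes> s) \<in> R" using x(2) r s by simp
    also have "x \<otimes> (r \<otimes> s) = (r \<otimes> x) \<otimes> s" using x(1) r s by algebra
    finally show ?thesis .
  qed
  moreover have "r \<otimes> x \<in> R" using x(2)[OF r] m_comm[OF r x(1)] by simp
  ultimately show "r \<otimes> x \<in> ext_conductor R S" by (simp add: ext_conductor_def)
qed

text \<open>
  For \<open>w\<^sup>2 \<in> (R : S)\<close> and any \<open>s\<close>, the square and the cube of \<open>w s\<close> are multiples of \<open>w\<^sup>2\<close>, so
  seminormality gives \<open>w s \<in> R\<close>: squares can be undone. Higher powers follow by halving the
  exponent, rounded up.
\<close>

lemma (in subring_pair) conductor_radical:
  assumes sn: "seminormal_extension R S" and z: "z \<in> carrier S"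
  shows "z [^] (n::nat) \<in> ext_conductor R S \<Longrightarrow> z \<in> ext_conductor R S"
proof (induction n rule: less_induct)
  case (less n)
  interpret I: ideal "ext_conductor R S" S by (rule conductor_ideal)
  have square: "w \<in> ext_conductor R S" if w: "w \<in> carrier S" "w \<otimes> w \<in> ext_conductor R S" for w
  proof -
    have wR: "w \<otimes> s \<in> R" if s: "s \<in> carrier S" for s
    proof -
      note ww = conductorD(2)[OF w(2)]
      have ws: "w \<otimes> s \<in> carrier S" using w(1) s by simp
      have "(w \<otimes> s) \<otimes> (w \<otimes> s) = (w \<otimes> w) \<otimes> (s \<otimes> s)" using w(1) s by algebra
      then have "(w \<otimes> s) [^] (2::nat) = (w \<otimes> w) \<otimes> (s \<otimes> s)"
        using nat_pow_Suc[of "w \<otimes> s" 1] nat_pow_eone[OF ws] by (simp only: Suc_1)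
      then have 2: "(w \<otimes> s) [^] (2::nat) \<in> R" using ww[of "s \<otimes> s"] s by (simp only: m_closed)
      have "(w \<otimes> s) [^] (3::nat) = (w \<otimes> s) [^] (2::nat) \<otimes> (w \<otimes> s)"
        using nat_pow_Suc[of "w \<otimes> s" 2] by (simp only: Suc_numeral semiring_norm)
      also have "\<dots> = (w \<otimes> w) \<otimes> (s \<otimes> s \<otimes> (w \<otimes> s))"
        using w(1) s ws \<open>(w \<otimes> s) [^] (2::nat) = _\<close> by (simp only: m_assoc m_closed)
      finally have 3: "(w \<otimes> s) [^] (3::nat) \<in> R"
        using ww[of "s \<otimes> s \<otimes> (w \<otimes> s)"] s ws by (simp only: m_closed)
      have "\<forall>b\<in>carrier S. b [^] (2::nat) \<in> R \<and> b [^] (3::nat) \<in> R \<longrightarrow> b \<in> R"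
        using sn unfolding seminormal_extension_def by (rule conjunct2)
      from bspec[OF this ws] show ?thesis using 2 3 by (rule mp[OF _ conjI])
    qed
    have "w \<in> R" using wR[OF one_closed] unfolding r_one[OF w(1)] .
    with wR show ?thesis unfolding ext_conductor_def by blast
  qed
  consider "n = 0" | "n = 1" | "n \<ge> 2" by linarith
  then show ?case
  proof cases
    case 1
    then have "\<one> \<in> ext_conductor R S" using less.prems by (simp only: nat_pow_0)
    then show ?thesis using I.one_imp_carrier z by blast
  next
    case 2
    then show ?thesis using less.prems nat_pow_eone[OF z] by (simp only:)
  next
    case 3
    define m where "m = (n + 1) div 2"
    have m: "m < n" "n \<le> m + m" using 3 by (auto simp: m_def)
    have "z [^] n \<otimes> z [^] (m + m - n) = z [^] m \<otimes> z [^] m"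
      unfolding nat_pow_mult[OF z] using m(2) by simp
    moreover have "z [^] n \<otimes> z [^] (m + m - n) \<in> ext_conductor R S"
      by (rule I.I_r_closed[OF less.prems nat_pow_closed[OF z]])
    ultimately have "z [^] m \<otimes> z [^] m \<in> ext_conductor R S" by (rule subst)
    then have "z [^] m \<in> ext_conductor R S" by (rule square[OF nat_pow_closed[OF z]])
    then show ?thesis by (rule less.IH[OF m(1)])
  qed
qed

locale locally_maximal_conductor = subring_pair +
  assumes locmax: "locally_maximal_ideal (ext_conductor R S) RR"
begin

abbreviation "I \<equiv> ext_conductor R S"

sublocale I: ideal I S by (rule conductor_ideal)

lemma I_R: "x \<in> I \<Longrightarrow> x \<in> R" by (simp add: ext_conductor_def)

text \<open>
  Of the alternatives \<open>I\<^sub>P = R\<^sub>P\<close> and \<open>I\<^sub>P = P R\<^sub>P\<close>, the first is impossible for \<open>I \<subseteq> P\<close>; the second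
  puts \<open>p/1\<close> in \<open>I\<^sub>P\<close>.
\<close>

lemma locally_maximalD:
  assumes P: "primeideal P RR" and IP: "I \<subseteq> P" and p: "p \<in> P"
  obtains s where "s \<in> R" "s \<notin> P" "s \<otimes> p \<in> I"
proof -
  interpret P: primeideal P RR by fact
  interpret F: fractions RR "R - P" by (rule fractions_RR[OF P])
  have disj: "P \<inter> (R - P) = {}" by auto
  have pR: "p \<in> R" using P.Icarr[OF p] by simp
  have li: "loc_ideal RR P I = F.fracs I" by (simp add: loc_ideal_def F.fracs_def)
  have ml: "max_loc_at RR P = F.fracs P" using P.max_loc_at_eq by simp
  have ne: "F.fracs I \<noteq> carrier F.L"
  proof
    assume eq: "F.fracs I = carrier F.L"
    have "\<one>\<^bsub>F.L\<^esub> \<in> F.fracs I" unfolding eq F.frac_one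
      using subringE(3)[OF R] F.one_M by (intro F.frac_carrier) auto
    then have "\<one>\<^bsub>F.L\<^esub> \<in> F.fracs P" using F.fracs_mono[OF IP] by blast
    then show False using F.fracs_prime_ne[OF P disj] by simp
  qed
  have "loc_ideal RR P I = carrier (loc_at RR P) \<or> loc_ideal RR P I = max_loc_at RR P"
    using locmax P unfolding locally_maximal_ideal_def by (elim conjE allE[of _ P]) (rule mp)
  then have "F.fracs I = carrier F.L \<or> F.fracs I = F.fracs P" unfolding li ml by simp
  with ne have "F.fracs I = F.fracs P" by argo
  then have "F.fract p \<one> \<in> F.fracs I" using p F.one_M by (simp add: F.fracsI)
  then obtain a s where a: "F.fract p \<one> = F.fract a s" "a \<in> I" "s \<in> R - P" by (rule F.fracsE)
  have eq_iff: "F.fract p \<one> = F.fract a s \<longleftrightarrow> (\<exists>u\<in>R - P. u \<otimes> (s \<otimes> p) = u \<otimes> (\<one> \<otimes> a))"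
    using F.frac_eq_iff[of p a \<one> s] F.one_M pR I_R[OF a(2)] a(3) by simp
  obtain u where u: "u \<in> R - P" "u \<otimes> (s \<otimes> p) = u \<otimes> (\<one> \<otimes> a)"
    using a(1) unfolding eq_iff by (rule bexE)
  have c: "u \<in> carrier S" "s \<in> carrier S" "p \<in> carrier S" using u(1) a(3) pR R_carr by auto
  have "u \<otimes> (\<one> \<otimes> a) \<in> I" using I.I_l_closed[OF a(2) c(1)] I.Icarr[OF a(2)] by simp
  then have "(u \<otimes> s) \<otimes> p \<in> I" unfolding u(2)[symmetric] m_assoc[OF c] .
  then show ?thesis using that[of "u \<otimes> s"] compl_closed(2)[OF P u(1) a(3)] by auto
qed

text \<open>
  For \<open>q \<in> Q\<close> some \<open>s \<notin> Q\<close> has \<open>s q \<in> I \<subseteq> P\<close>; as \<open>P \<subseteq> Q\<close>, also \<open>s \<notin> P\<close>, so \<open>q \<in> P\<close>.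
\<close>

lemma primes_over_conductor_incomparable:
  assumes P: "primeideal P RR" and Q: "primeideal Q RR" and IP: "I \<subseteq> P" and PQ: "P \<subseteq> Q"
  shows "P = Q"
proof
  interpret P: primeideal P RR by fact
  interpret Q: primeideal Q RR by fact
  show "Q \<subseteq> P"
  proof
    fix q assume q: "q \<in> Q"
    then obtain s where s: "s \<in> R" "s \<notin> Q" "s \<otimes> q \<in> I" using locally_maximalD[OF Q _ q] IP PQ by blast
    then have "s \<in> P \<or> q \<in> P" using P.I_prime[of s q] Q.Icarr[OF q] IP by auto
    then show "q \<in> P" using s PQ by auto
  qed
qed fact

lemma prime_over_conductor_maximal:
  assumes P: "primeideal P RR" and IP: "I \<subseteq> P"
  shows "maximalideal P RR"
proof (rule maximalidealI)
  interpret P: primeideal P RR by fact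
  show "ideal P RR" "carrier RR \<noteq> P" by (rule P.is_ideal, rule P.I_notcarr)
  fix J assume J: "ideal J RR" "P \<subseteq> J" "J \<subseteq> carrier RR"
  interpret J: ideal J RR by fact
  show "J = P \<or> J = carrier RR"
  proof (rule disjCI)
    assume "J \<noteq> carrier RR"
    then have "J \<inter> {\<one>} = {}" using J.one_imp_carrier by auto
    then obtain Q where Q: "primeideal Q RR" "J \<subseteq> Q"
      using RR.exists_prime_avoiding[OF J(1), of "{\<one>}"] subringE(3)[OF R] by auto
    then have "P = Q" using primes_over_conductor_incomparable[OF P Q(1) IP] J by blast
    then show "J = P" using J Q by blast
  qed
qed

lemma supp_over_conductor:
  assumes "P \<in> ext_supp R S" shows "primeideal P RR" "I \<subseteq> P" "maximalideal P RR"
proof -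
  show P: "primeideal P RR" using assms ext_supp_iff by simp
  show IP: "I \<subseteq> P"
  proof (rule ccontr)
    assume "\<not> I \<subseteq> P"
    then obtain s where s: "s \<in> I" "s \<notin> P" by auto
    have "x \<in> sat P R" if x: "x \<in> carrier S" for x
      using conductorD[OF s(1)] s(2) x by (intro satI[OF x, of s]) simp_all
    then have "sat P R = carrier S" using sat_subset[of P R] by blast
    then show False using assms by (simp add: ext_supp_iff)
  qed
  show "maximalideal P RR" by (rule prime_over_conductor_maximal[OF P IP])
qed

text \<open>
  So finiteness of the maximal support controls the whole support, as \<open>finite_intermediate_rings\<close> needs.
\<close>

lemma msupp_eq_supp: "ext_msupp R S = ext_supp R S"
  using supp_over_conductor by (auto simp: ext_msupp_def)

text \<open>
  A product of elements that separate \<open>P\<close> from each single member of \<open>F\<close>.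
\<close>

lemma avoid_supp_prime:
  assumes "finite F" "F \<subseteq> ext_supp R S" "P \<in> ext_supp R S" "P \<notin> F"
  shows "\<exists>c\<in>R. c \<notin> P \<and> (\<forall>P'\<in>F. c \<in> P')"
  using assms
proof (induction F rule: finite_induct)
  case empty
  then show ?case using compl_closed(1) supp_over_conductor by blast
next
  case (insert P' F)
  then obtain c where c: "c \<in> R" "c \<notin> P" "\<forall>P'\<in>F. c \<in> P'" by auto
  have P: "primeideal P RR" and P': "primeideal P' RR" "I \<subseteq> P'"
    using supp_over_conductor insert.prems by auto
  interpret P': primeideal P' RR by fact
  have "\<not> P' \<subseteq> P" using primes_over_conductor_incomparable[OF P'(1) P P'(2)] insert.prems by auto
  then obtain d where d: "d \<in> P'" "d \<notin> P" by auto
  have dR: "d \<in> R" using P'.Icarr[OF d(1)] by simp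
  have "c \<otimes> d \<in> R" "c \<otimes> d \<notin> P" using compl_closed(2)[OF P, of c d] c d dR by auto
  moreover have "c \<otimes> d \<in> P'" using P'.I_l_closed[OF d(1), of c] c by simp
  moreover have "c \<otimes> d \<in> Q" if "Q \<in> F" for Q
  proof -
    have "Q \<in> ext_supp R S" using that insert.prems by auto
    from supp_over_conductor(1)[OF this] interpret Q: primeideal Q RR .
    show ?thesis using Q.I_r_closed[of c d] c dR that by simp
  qed
  ultimately show ?case by (intro bexI[of _ "c \<otimes> d"]) auto
qed

text \<open>
  \<open>T n\<close> consists of the elements of \<open>S\<close> that lie in \<open>R\<^sub>P\<close> at the first \<open>n\<close> primes of an infinite
  sequence in the support. To see that it shrinks at step \<open>n\<close>, take \<open>y\<close> outside \<open>R\<^sub>P\<close> at the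
  prime \<open>p n\<close> and multiply it by some \<open>c\<close> in the earlier primes but not in \<open>p n\<close>: locally at each
  earlier prime \<open>c\<close> lies in the conductor, and at \<open>p n\<close> it is a unit.
\<close>

lemma finite_supp_if_FCP:
  assumes "FCP R S" shows "finite (ext_supp R S)"
proof (rule ccontr)
  assume "infinite (ext_supp R S)"
  then obtain p :: "nat \<Rightarrow> _" where p: "inj p" "range p \<subseteq> ext_supp R S"
    by (metis infinite_countable_subset)
  define T where "T n = (carrier S \<inter> (\<Inter>i<n. sat (p i) R))" for n
  have pr: "primeideal (p i) RR" for i using p supp_over_conductor by auto
  have T: "T n \<in> intermediate_rings R S" for n
  proof (induction n)
    case 0
    have "T 0 = carrier S" by (simp add: T_def)
    then show ?case using carrier_is_subring R_carr by (auto simp: intermediate_rings_def)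
  next
    case (Suc n)
    have "T (Suc n) = T n \<inter> sat (p n) R" by (auto simp: T_def less_Suc_eq)
    then show ?case using Int_intermediate[OF Suc sat_subring[OF pr R_intermediate]] by simp
  qed
  have anti: "T n \<subseteq> T m" if "m \<le> n" for m n using that by (auto simp: T_def)
  have strict: "T (Suc n) \<noteq> T n" for n
  proof -
    have "sat (p n) R \<noteq> carrier S" using p ext_supp_iff by auto
    then obtain y where y: "y \<in> carrier S" "y \<notin> sat (p n) R" using sat_subset by blast
    have "p n \<notin> p ` {..<n}" using p(1) by (auto dest: injD)
    moreover have "p ` {..<n} \<subseteq> ext_supp R S" "p n \<in> ext_supp R S" using p(2) by auto
    ultimately obtain c where c: "c \<in> R" "c \<notin> p n" "\<forall>i<n. c \<in> p i"
      using avoid_supp_prime[of "p ` {..<n}" "p n"] by auto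
    have "c \<otimes> y \<in> sat (p i) R" if i: "i < n" for i
    proof -
      have "p i \<in> ext_supp R S" using p by auto
      then obtain s where s: "s \<in> R" "s \<notin> p i" "s \<otimes> c \<in> I"
        using locally_maximalD[OF pr supp_over_conductor(2)] c i by blast
      have "(s \<otimes> c) \<otimes> y \<in> R" using conductorD(2)[OF s(3) y(1)] .
      then have "s \<otimes> (c \<otimes> y) \<in> R" using m_assoc[of s c y] s(1) c(1) y(1) R_carr by simp
      then show ?thesis using s c(1) y(1) R_carr by (intro satI[of _ s]) simp_all
    qed
    then have "c \<otimes> y \<in> T n" using c y R_carr by (auto simp: T_def)
    moreover have "c \<otimes> y \<notin> sat (p n) R"
    proof
      assume "c \<otimes> y \<in> sat (p n) R"
      then obtain s where s: "s \<in> R" "s \<notin> p n" "s \<otimes> (c \<otimes> y) \<in> R" by (rule satE)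
      then have "(s \<otimes> c) \<otimes> y \<in> R" using c y R_carr by (auto simp: m_assoc)
      moreover have "s \<otimes> c \<in> R - p n" using compl_closed(2)[OF pr] s c by auto
      ultimately show False using y satI by blast
    qed
    ultimately show ?thesis by (auto simp: T_def)
  qed
  have "T n \<noteq> T m" if "m < n" for m n
  proof
    assume "T n = T m"
    with anti[of "Suc m" n] anti[of m "Suc m"] that have "T (Suc m) = T m" by auto
    then show False using strict by simp
  qed
  then have "inj T" by (metis injI linorder_neqE_nat)
  then have "infinite (range T)" using finite_imageD by blast
  moreover have "subset.chain (intermediate_rings R S) (range T)"
    unfolding subset_chain_def
  proof (intro conjI ballI)
    show "range T \<subseteq> intermediate_rings R S" using T by auto
    fix x y assume "x \<in> range T" "y \<in> range T"
    then obtain m n where "x = T m" "y = T n" by auto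
    then show "x \<subseteq> y \<or> y \<subseteq> x" using anti[of m n] anti[of n m] by (cases "m \<le> n") auto
  qed
  ultimately show False using assms by (auto simp: FCP_def)
qed

end

section \<open>Fibers over the support\<close>

context locally_maximal_conductor begin

lemma prime_over_in_fiber:
  assumes P: "primeideal P RR" "I \<subseteq> P" and Q: "primeideal Q S" "I \<subseteq> Q" "Q \<inter> (R - P) = {}"
  shows "Q \<in> ext_fiber R S P"
proof -
  interpret Q: primeideal Q S by fact
  interpret P: primeideal P RR by fact
  have "p \<in> Q" if p: "p \<in> P" for p
  proof -
    obtain s where s: "s \<in> R" "s \<notin> P" "s \<otimes> p \<in> I" by (rule locally_maximalD[OF P p])
    have pR: "p \<in> R" using P.Icarr[OF p] by simp
    have "s \<otimes> p \<in> Q" using s(3) Q(2) by (rule rev_subsetD)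
    then have "s \<in> Q \<or> p \<in> Q" by (rule Q.I_prime[OF R_carr[OF s(1)] R_carr[OF pR]])
    then show ?thesis using s Q(3) by blast
  qed
  moreover have "P \<subseteq> R" using P.Icarr by auto
  ultimately have "Q \<inter> R = P" using Q(3) by blast
  then show ?thesis using Q(1) by (simp add: ext_fiber_def)
qed

text \<open>
  Otherwise a prime of \<open>S\<close> containing \<open>I\<close> misses all \<open>s z\<^sup>n\<close>. As it misses \<open>R - P\<close>, it lies in the
  fiber at \<open>P\<close>, but it misses \<open>z\<close>. When some \<open>s z\<^sup>n\<close> is in \<open>I\<close>, so is a power of \<open>s z\<close>, and \<open>I\<close> is
  radical.
\<close>

lemma fiber_radical:
  assumes sn: "seminormal_extension R S" and P: "primeideal P RR" "I \<subseteq> P"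
    and z: "z \<in> carrier S" "\<And>Q. Q \<in> ext_fiber R S P \<Longrightarrow> z \<in> Q"
  obtains s where "s \<in> R" "s \<notin> P" "s \<otimes> z \<in> I"
proof -
  let ?N = "{s \<otimes> z [^] (n::nat) | s n. s \<in> R - P}"
  note cl = compl_closed[OF P(1)]
  have c: "s \<in> carrier S" if "s \<in> R - P" for s using that R_carr by simp
  have memN: "s \<otimes> z [^] n \<in> ?N" if "s \<in> R - P" for s and n :: nat
    using that by blast
  show ?thesis
  proof (cases "I \<inter> ?N = {}")
    case True
    obtain Q where Q: "primeideal Q S" "I \<subseteq> Q" "Q \<inter> ?N = {}"
    proof (rule exists_prime_avoiding[OF I.is_ideal _ _ _ True])
      show "?N \<subseteq> carrier S" using c z(1) by auto
      show "\<one> \<in> ?N" using memN[OF cl(1), of 0] by simp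
      fix x y assume "x \<in> ?N" "y \<in> ?N"
      then obtain s t and m n :: nat where x: "x = s \<otimes> z [^] m" "s \<in> R - P"
        and y: "y = t \<otimes> z [^] n" "t \<in> R - P" by blast
      note cc = c[OF x(2)] c[OF y(2)] nat_pow_closed[OF z(1), of m] nat_pow_closed[OF z(1), of n]
      have "x \<otimes> y = (s \<otimes> t) \<otimes> (z [^] m \<otimes> z [^] n)" unfolding x(1) y(1) using cc by algebra
      also have "\<dots> = (s \<otimes> t) \<otimes> z [^] (m + n)" unfolding nat_pow_mult[OF z(1)] ..
      finally have "x \<otimes> y = (s \<otimes> t) \<otimes> z [^] (m + n)" .
      then show "x \<otimes> y \<in> ?N" using memN[OF cl(2)[OF x(2) y(2)]] by simp
    qed
    have "s \<in> ?N" if "s \<in> R - P" for s using memN[OF that, of 0] c[OF that] by simp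
    then have "Q \<inter> (R - P) = {}" using Q(3) by blast
    then have "Q \<in> ext_fiber R S P" by (rule prime_over_in_fiber[OF P Q(1,2)])
    then have "z \<in> Q" by (rule z(2))
    moreover have "z \<in> ?N" using memN[OF cl(1), of 1] z(1) by simp
    ultimately show ?thesis using Q(3) by blast
  next
    case False
    then obtain s n where s: "s \<in> R - P" "s \<otimes> z [^] (n::nat) \<in> I" by blast
    note cc = c[OF s(1)] z(1)
    \<comment> \<open>The exponent \<open>n + 1\<close> instead of \<open>n\<close> covers the case \<open>n = 0\<close>.\<close>
    have "(s \<otimes> z) [^] Suc n = (s [^] n \<otimes> z) \<otimes> (s \<otimes> z [^] n)"
      using cc nat_pow_distrib[OF cc, of n] by (simp add: m_ac)
    also have "\<dots> \<in> I" using cc by (intro I.I_l_closed[OF s(2)]) simp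
    finally have "s \<otimes> z \<in> I" by (rule conductor_radical[OF sn m_closed[OF cc]])
    then show ?thesis using that[of s] s(1) by simp
  qed
qed

text \<open>
  Since \<open>P\<close> is maximal, the denominator in \<open>infra_integral_residue\<close> can be inverted modulo \<open>P \<subseteq> Q\<close>.
\<close>

lemma residue_at_maximal:
  assumes infra: "infra_integral_extension R S" and P: "maximalideal P RR"
    and Q: "Q \<in> ext_fiber R S P" and x: "x \<in> carrier S"
  obtains a where "a \<in> R" "x \<ominus> a \<in> Q"
proof -
  have Q: "primeideal Q S" "Q \<inter> R = P" using Q by (simp_all add: ext_fiber_def)
  interpret Q: primeideal Q S by fact
  obtain a s where a: "a \<in> R" "s \<in> R" "s \<notin> Q" "s \<otimes> x \<ominus> a \<in> Q"
    by (rule infra_integral_residue[OF R infra Q(1) x])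
  have sP: "s \<notin> P" using a Q(2) by auto
  obtain i u where i: "i \<in> P" "u \<in> R" "i \<oplus> u \<otimes> s = \<one>"
    using RR.inverse_mod_maximalideal[OF P, of s] a(2) sP by auto
  have iQ: "i \<in> Q" using i(1) Q(2) by auto
  note c = Q.Icarr[OF iQ] R_carr[OF a(1)] R_carr[OF a(2)] R_carr[OF i(2)] x
  have "x \<ominus> u \<otimes> a = (i \<oplus> u \<otimes> s) \<otimes> x \<ominus> u \<otimes> a" unfolding i(3) using x by simp
  also have "\<dots> = i \<otimes> x \<oplus> u \<otimes> (s \<otimes> x \<ominus> a)" using c by algebra
  also have "\<dots> \<in> Q" using Q.I_r_closed[OF iQ x] Q.I_l_closed[OF a(4) c(4)] by (rule Q.a_closed)
  finally show ?thesis using that subringE(6)[OF R i(2) a(1)] by blast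
qed

text \<open>
  If all primes of the fiber were equal to a single \<open>Q\<close>, then each \<open>x\<close> would be congruent to some
  \<open>a \<in> R\<close> modulo the whole fiber, so that \<open>s (x - a) \<in> I \<subseteq> R\<close> with \<open>s \<notin> P\<close> and \<open>x \<in> R\<^sub>P\<close>. An empty
  fiber is included, with \<open>a = 0\<close>.
\<close>

lemma supp_fiber:
  assumes sn: "seminormal_extension R S" and infra: "infra_integral_extension R S"
    and fib: "finite (ext_fiber R S P)" "card (ext_fiber R S P) \<le> 2"
    and supp: "P \<in> ext_supp R S"
  obtains Q1 Q2 where "Q1 \<noteq> Q2" "ext_fiber R S P = {Q1, Q2}"
proof -
  note P = supp_over_conductor[OF supp]
  have "\<not> ext_fiber R S P \<subseteq> {Q}" for Q
  proof
    assume sub: "ext_fiber R S P \<subseteq> {Q}"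
    have "x \<in> sat P R" if x: "x \<in> carrier S" for x
    proof -
      have "\<exists>a\<in>R. \<forall>Q'\<in>ext_fiber R S P. x \<ominus> a \<in> Q'"
      proof (cases "Q \<in> ext_fiber R S P")
        case True
        obtain a where "a \<in> R" "x \<ominus> a \<in> Q" by (rule residue_at_maximal[OF infra P(3) True x])
        then show ?thesis using sub by blast
      next
        case False
        then have "ext_fiber R S P = {}" using sub by blast
        then show ?thesis using subringE(2)[OF R] by auto
      qed
      then obtain a where a: "a \<in> R" "\<And>Q'. Q' \<in> ext_fiber R S P \<Longrightarrow> x \<ominus> a \<in> Q'" by blast
      note ac = R_carr[OF a(1)]
      obtain s where s: "s \<in> R" "s \<notin> P" "s \<otimes> (x \<ominus> a) \<in> I"
        by (rule fiber_radical[OF sn P(1,2) minus_closed[OF x ac] a(2)])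
      have "s \<otimes> (x \<ominus> a) \<oplus> s \<otimes> a \<in> R"
        using I_R[OF s(3)] subringE(6)[OF R s(1) a(1)] by (rule subringE(7)[OF R])
      also have "s \<otimes> (x \<ominus> a) \<oplus> s \<otimes> a = s \<otimes> x" using R_carr[OF s(1)] ac x by algebra
      finally show ?thesis using s(1,2) by (intro satI[OF x, of s]) simp_all
    qed
    then have "sat P R = carrier S" using sat_subset[of P R] by blast
    then show False using supp by (simp add: ext_supp_iff)
  qed
  then have "card (ext_fiber R S P) \<noteq> 0" "card (ext_fiber R S P) \<noteq> 1"
    using fib(1) by (auto simp: card_1_singleton_iff)
  then have "card (ext_fiber R S P) = 2" using fib(2) by linarith
  then show ?thesis using that by (auto simp: card_2_iff)
qed

text \<open>
  The criterion applies to the local ring \<open>R\<^sub>P\<close> with maximal ideal \<open>P R\<^sub>P\<close>, and to the ideals of \<open>S\<^sub>P\<close>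
  generated by \<open>Q1\<close> and \<open>Q2\<close>. That their intersection is inside \<open>R\<^sub>P\<close> is \<open>fiber_radical\<close>: it even
  lies in the localized conductor.
\<close>

lemma minimal_decomposed_at:
  assumes sn: "seminormal_extension R S" and infra: "infra_integral_extension R S"
    and supp: "P \<in> ext_supp R S" and fib: "ext_fiber R S P = {Q1, Q2}" "Q1 \<noteq> Q2"
  shows "minimal_decomposed (ext_loc_base R S P) (ext_loc_top R S P)"
proof -
  note P = supp_over_conductor[OF supp]
  interpret P: maximalideal P RR by (rule P(3))
  interpret G: fractions S "R - P" by (rule fractions_S[OF P(1)])
  interpret GL: cring G.L by (rule G.L_cring)
  let ?A = "G.fracs R"
  have Q: "primeideal Q S" "Q \<inter> R = P" if "Q \<in> ext_fiber R S P" for Q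
    using that by (simp_all add: ext_fiber_def)
  have A: "subring ?A G.L" by (rule G.fracs_subring[OF R]) simp
  interpret A: cring "G.L\<lparr>carrier := ?A\<rparr>" by (rule GL.subring_cring[OF A])
  have PR: "P \<subseteq> R" using P.Icarr by auto
  have disj: "Q \<inter> (R - P) = {}" if "Q \<in> ext_fiber R S P" for Q using Q(2)[OF that] by blast
  note mem = G.frac_in_fracs_prime[OF Q(1) disj]
  have contract: "G.fracs Q \<inter> ?A = G.fracs P" if F: "Q \<in> ext_fiber R S P" for Q
  proof
    have "P \<subseteq> Q" using Q(2)[OF F] by blast
    then show "G.fracs P \<subseteq> G.fracs Q \<inter> ?A" using G.fracs_mono PR by auto
    show "G.fracs Q \<inter> ?A \<subseteq> G.fracs P"
    proof
      fix y assume y: "y \<in> G.fracs Q \<inter> ?A"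
      from y have "y \<in> ?A" by simp
      then obtain a s where a: "y = G.fract a s" "a \<in> R" "s \<in> R - P" by (rule G.fracsE)
      have "a \<in> Q" using y mem[OF F F R_carr[OF a(2)] a(3)] a(1) by simp
      then show "y \<in> G.fracs P" unfolding a(1) using a Q(2)[OF F] by (intro G.fracsI) auto
    qed
  qed
  have F1: "Q1 \<in> ext_fiber R S P" and F2: "Q2 \<in> ext_fiber R S P" using fib by auto
  have iQ: "ideal Q S" if "Q \<in> ext_fiber R S P" for Q using Q(1)[OF that] by (rule primeideal.axioms(1))
  have iM: "ideal (G.fracs Q) G.L" if "Q \<in> ext_fiber R S P" for Q
    by (rule G.fracs_ideal[OF iQ[OF that]])
  have residue: "\<exists>b\<in>?A. y \<ominus>\<^bsub>G.L\<^esub> b \<in> G.fracs Q" if F: "Q \<in> ext_fiber R S P" and y: "y \<in> carrier G.L" for Q y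
  proof -
    from y obtain x t where x: "y = G.fract x t" "x \<in> carrier S" "t \<in> R - P" by (rule G.fracE)
    obtain a where a: "a \<in> R" "x \<ominus> a \<in> Q" by (rule residue_at_maximal[OF infra P(3) F x(2)])
    note c = x(2) R_carr[OF a(1)] G.M_carr[OF x(3)]
    have "y \<ominus>\<^bsub>G.L\<^esub> G.fract a t = G.fract (t \<otimes> x \<oplus> t \<otimes> (\<ominus> a)) (t \<otimes> t)"
      unfolding x(1) GL.minus_eq using c x(3) by (simp add: G.frac_uminus G.frac_add)
    also have "t \<otimes> x \<oplus> t \<otimes> (\<ominus> a) = t \<otimes> (x \<ominus> a)" using c by algebra
    also have "G.fract (t \<otimes> (x \<ominus> a)) (t \<otimes> t) \<in> G.fracs Q"
      by (intro G.fracsI ideal.I_l_closed[OF iQ[OF F]] a(2) c(3) G.mult_M x(3))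
    finally show ?thesis using G.fracsI[OF a(1) x(3)] by blast
  qed
  have "maximalideal (G.fracs P) (G.L\<lparr>carrier := ?A\<rparr>)"
  proof (rule A.maximalidealI_units)
    interpret M: ideal "G.fracs Q1" G.L by (rule iM[OF F1])
    note AE = subringE[OF A]
    show "ideal (G.fracs P) (G.L\<lparr>carrier := ?A\<rparr>)"
      unfolding contract[OF F1, symmetric]
    proof (rule A.idealI_cring)
      show "r \<otimes>\<^bsub>G.L\<lparr>carrier := ?A\<rparr>\<^esub> x \<in> G.fracs Q1 \<inter> ?A"
        if "r \<in> carrier (G.L\<lparr>carrier := ?A\<rparr>)" "x \<in> G.fracs Q1 \<inter> ?A" for r x
        using that M.I_l_closed[of x r] AE(1,6) by auto
    qed (use AE(2,7) in auto)
    show "\<one>\<^bsub>G.L\<lparr>carrier := ?A\<rparr>\<^esub> \<notin> G.fracs P"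
      using G.fracs_prime_ne[OF Q(1)[OF F1] disj[OF F1]] contract[OF F1] by auto
    fix y assume "y \<in> carrier (G.L\<lparr>carrier := ?A\<rparr>)" "y \<notin> G.fracs P"
    then obtain a s where a: "y = G.fract a s" "a \<in> R" "s \<in> R - P" and y: "y \<notin> G.fracs P"
      by (auto elim: G.fracsE)
    have aP: "a \<in> R - P" using y a G.fracsI[of a P s] by auto
    note c = R_carr[OF a(2)] G.M_carr[OF a(3)]
    have "G.fract s a \<otimes>\<^bsub>G.L\<^esub> y = G.fract (s \<otimes> a) (a \<otimes> s)"
      unfolding a(1) using c aP a(3) by (simp only: G.frac_mult)
    also have "\<dots> = \<one>\<^bsub>G.L\<^esub>"
      unfolding G.frac_one using c G.mult_M[OF aP a(3)] G.one_M by (intro G.frac_eqI) (simp_all add: m_comm)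
    finally have "G.fract s a \<otimes>\<^bsub>G.L\<^esub> y = \<one>\<^bsub>G.L\<^esub>" .
    then show "\<exists>u\<in>carrier (G.L\<lparr>carrier := ?A\<rparr>). u \<otimes>\<^bsub>G.L\<lparr>carrier := ?A\<rparr>\<^esub> y = \<one>\<^bsub>G.L\<lparr>carrier := ?A\<rparr>\<^esub>"
      using G.fracsI[of s R a] aP a(3) by auto
  qed
  moreover have "G.fracs Q1 \<noteq> G.fracs Q2"
  proof
    assume eq: "G.fracs Q1 = G.fracs Q2"
    have "x \<in> Q1 \<longleftrightarrow> x \<in> Q2" if "x \<in> carrier S" for x
      using mem[OF F1 F1 that G.one_M] mem[OF F2 F2 that G.one_M] eq by simp
    then show False using fib(2) ideal.Icarr[OF iQ[OF F1]] ideal.Icarr[OF iQ[OF F2]] by blast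
  qed
  moreover have "G.fracs Q1 \<inter> G.fracs Q2 \<subseteq> ?A"
  proof
    fix y assume y: "y \<in> G.fracs Q1 \<inter> G.fracs Q2"
    then have "y \<in> G.fracs Q1" by simp
    then obtain x t where x: "y = G.fract x t" "x \<in> Q1" "t \<in> R - P" by (rule G.fracsE)
    have xc: "x \<in> carrier S" by (rule ideal.Icarr[OF iQ[OF F1] x(2)])
    have "x \<in> Q2" using y mem[OF F2 F2 xc x(3)] x(1) by simp
    then have "x \<in> Q" if "Q \<in> ext_fiber R S P" for Q using that x(2) fib(1) by auto
    then obtain s where s: "s \<in> R" "s \<notin> P" "s \<otimes> x \<in> I" by (rule fiber_radical[OF sn P(1,2) xc])
    then have "x \<in> sat P R" using I_R by (intro satI[OF xc, of s]) simp_all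
    then show "y \<in> ?A" using frac_in_fracs_sat[OF P(1) R_intermediate xc x(3)] x(1) by simp
  qed
  ultimately show ?thesis
    unfolding ext_loc_base_eq[OF P(1)] ext_loc_top_def
    using GL.minimal_decomposedI[OF A _ iM[OF F1] iM[OF F2] _ contract[OF F1] contract[OF F2]]
      residue[OF F1] residue[OF F2] by blast
qed

end

section \<open>Distributivity, local minimality and finiteness\<close>

theorem proposition7p4:
  fixes S :: "('a, 'b) ring_scheme" and R :: "'a set"
  assumes "ring_extension R S" and "R \<noteq> carrier S"
    and "seminormal_extension R S"
    and "infra_integral_extension R S"
    and "locally_maximal_ideal (ext_conductor R S) (S\<lparr>carrier := R\<rparr>)"
    and "\<And>P. primeideal P (S\<lparr>carrier := R\<rparr>) \<Longrightarrow>
           finite (ext_fiber R S P) \<and> card (ext_fiber R S P) \<le> 2"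
  shows "distributive_extension R S \<and> locally_minimal_decomposed R S \<and>
         (FCP R S \<longleftrightarrow> finite (ext_msupp R S)) \<and> (FCP R S \<longrightarrow> FIP R S)"
proof -
  interpret cring S using assms(1) by (simp add: ring_extension_def)
  interpret locally_maximal_conductor S R
    using assms(1,5)
    by (intro locally_maximal_conductor.intro subring_pair.intro subring_pair_axioms.intro
        locally_maximal_conductor_axioms.intro is_cring) (simp_all add: ring_extension_def)
  have lm: "locally_minimal_decomposed R S"
    unfolding locally_minimal_decomposed_def
  proof (intro conjI ballI assms(1))
    fix P assume supp: "P \<in> ext_supp R S"
    note fib = assms(6)[OF supp_over_conductor(1)[OF supp]]
    obtain Q1 Q2 where "Q1 \<noteq> Q2" "ext_fiber R S P = {Q1, Q2}"
      using supp_fiber[OF assms(3,4) conjunct1[OF fib] conjunct2[OF fib] supp] by blast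
    then show "minimal_decomposed (ext_loc_base R S P) (ext_loc_top R S P)"
      using minimal_decomposed_at[OF assms(3,4) supp] by blast
  qed
  have FIP: "FIP R S" if "finite (ext_msupp R S)"
    using finite_intermediate_rings[OF lm] that by (simp add: FIP_def msupp_eq_supp)
  have "FCP R S" if "FIP R S"
    unfolding FCP_def using that by (auto simp: FIP_def subset_chain_def intro: finite_subset)
  moreover have "finite (ext_msupp R S)" if "FCP R S"
    using finite_supp_if_FCP[OF that] by (simp add: msupp_eq_supp)
  ultimately show ?thesis using distributive_if_locally_minimal[OF lm] lm FIP by blast
qed

end
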